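(* Suppose that the states are numbered so that the hyperlink matrix has the block form $$P=\begin{bmatrix} Q_1 & & 0 & 0\\ & \ddots & & \\ 0 & & Q_m & 0\\ \tilde R_1 & \cdots & \tilde R_m & \tilde T\end{bmatrix},$$ where $Q_1,\dots,Q_m$ ($m\ge 1$) correspond to the absorbing (closed) strongly connected components of $P$ inside the Pure OUT component, and $\tilde T$ corresponds to all remaining nodes. For $i=1,\dots,m$ let $\mu_i$ be the limiting stationary distribution of the Markov process governed by $P$ when the process settles in $Q_i$, i.e. the unique solution (row vector) of $$\mu_i Q_i=\mu_i,\qquad \mu_i\mathbf 1=1 .$$ Then the PageRank vector $\pi(c)$ satisfies $$\lim_{c\to 1}\pi(c)=\left[\bar\pi_1\ \cdots\ \bar\pi_m\ 0\right],$$ where $$\bar\pi_i=\left(\frac{n_i}{n}+\frac{n_{\tilde T}}{n}\,u_{\tilde T}[I-\tilde T]^{-1}\tilde R_i\mathbf 1\right)\mu_i,\qquad i=1,\dots,m,$$ and the zeros at the end of the limiting vector correspond to all nodes which are not in any $Q_i$, $i=1,\dots,m$.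
   Context: Hyperlink matrix: for a finite directed graph (Web Graph) on $n$ pages, $P=(p_{ij})$ is the $n\times n$ stochastic matrix with $p_{ij}=1/d_i$ if page $i$ links to page $j$ (where $d_i$ is the number of outgoing links of $i$), $p_{ij}=1/n$ for all $j$ if page $i$ is dangling (has no outgoing links), and $p_{ij}=0$ otherwise. PageRank: for $c\in(0,1)$ the Google matrix is $G=cP+(1-c)\frac1n E$, with $E$ the all-ones $n\times n$ matrix; $\pi=\pi(c)$ is the unique row vector with $\pi G=\pi$, $\pi\mathbf 1=1$. Here $\mathbf 1$ denotes a column vector of ones of the appropriate dimension. The limit $c\to1$ is taken over $c\in(0,1)$. ESCC and Pure OUT: it is assumed that there is at least one dangling page. The Extended Strongly Connected Component (ESCC) is the strongly connected component of the graph induced by $P$ (i.e. with edges $i\to j$ whenever $p_{ij}>0$) that contains the dangling pages; it consists of the dangling pages and all pages from which a dangling page is reachable. The Pure OUT component is the set of all remaining pages, assumed nonempty; no page of ESCC is reachable from it. The random walk governed by $P$ is eventually absorbed in one of the closed strongly connected components inside Pure OUT, which are the blocks $Q_1,\dots,Q_m$. The block $\tilde T$ contains the ESCC nodes together with those Pure OUT nodes that are transient (not in any $Q_i$). Notation: $n_i$ is the number of nodes in block $Q_i$, $n_{\tilde T}$ is the number of nodes in block $\tilde T$, and $u_{\tilde T}$ is the uniform probability row vector on the $n_{\tilde T}$ nodes of block $\tilde T$. *)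

theory Defs
  imports
    Complex_Main
    "Jordan_Normal_Form.Gauss_Jordan_Elimination"
    "Graph_Theory.Pair_Digraph"
    "Graph_Theory.Digraph_Component"
begin

text \<open>
  Pages are the numbers below n, and a Web Graph is a digraph without parallel arcs on these
  vertices (self-links are not excluded).  Row vectors are represented by \<^typ>\<open>real vec\<close>;
  the product of the row vector v with the matrix A is \<open>mat_of_row v * A\<close>.
\<close>

definition dangling_pages :: "nat pair_pre_digraph \<Rightarrow> nat set" where
  "dangling_pages W = {i \<in> pverts W. out_degree (with_proj W) i = 0}"

definition hyperlink_matrix :: "nat \<Rightarrow> nat pair_pre_digraph \<Rightarrow> real mat" where
  "hyperlink_matrix n W = mat n n (\<lambda>(i, j).
     if i \<in> dangling_pages W then 1 / real n
     else if (i, j) \<in> parcs W then 1 / real (out_degree (with_proj W) i)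
     else 0)"

definition ones_vec :: "nat \<Rightarrow> real vec" where
  "ones_vec k = vec k (\<lambda>_. 1)"

definition uniform_vec :: "nat \<Rightarrow> real vec" where
  "uniform_vec k = vec k (\<lambda>_. 1 / real k)"

definition google_matrix :: "real mat \<Rightarrow> real \<Rightarrow> real mat" where
  "google_matrix P c = (let n = dim_row P in
     c \<cdot>\<^sub>m P + ((1 - c) * (1 / real n)) \<cdot>\<^sub>m mat n n (\<lambda>_. 1))"

definition is_stationary :: "real mat \<Rightarrow> real vec \<Rightarrow> bool" where
  "is_stationary A v \<longleftrightarrow> v \<in> carrier_vec (dim_row A) \<and>
     mat_of_row v * A = mat_of_row v \<and> v \<bullet> ones_vec (dim_row A) = 1"

definition stationary :: "real mat \<Rightarrow> real vec" where
  "stationary A = (THE v. is_stationary A v)"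

definition pagerank :: "real mat \<Rightarrow> real \<Rightarrow> real vec" where
  "pagerank P c = stationary (google_matrix P c)"

definition matrix_graph :: "real mat \<Rightarrow> nat pair_pre_digraph" where
  "matrix_graph A = \<lparr> pverts = {..<dim_row A},
     parcs = {(i, j). i < dim_row A \<and> j < dim_col A \<and> A $$ (i, j) > 0} \<rparr>"

definition scc_sets :: "real mat \<Rightarrow> nat set set" where
  "scc_sets A = pre_digraph.sccs_verts (with_proj (matrix_graph A))"

definition closed_set :: "real mat \<Rightarrow> nat set \<Rightarrow> bool" where
  "closed_set A S \<longleftrightarrow> (\<forall>i\<in>S. \<forall>j. (i, j) \<in> parcs (matrix_graph A) \<longrightarrow> j \<in> S)"

text \<open>
  The component is unique as soon as there is a dangling page: dangling pages have a positive
  transition probability to every page, so they all lie in the same component.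
\<close>

definition ESCC :: "nat \<Rightarrow> nat pair_pre_digraph \<Rightarrow> nat set" where
  "ESCC n W = (THE S. S \<in> scc_sets (hyperlink_matrix n W) \<and> dangling_pages W \<subseteq> S)"

definition pure_OUT :: "nat \<Rightarrow> nat pair_pre_digraph \<Rightarrow> nat set" where
  "pure_OUT n W = pverts W - ESCC n W"

text \<open>
  \<open>block ns i\<close> is the set of positions occupied by the i-th block (counting from 0) when blocks of
  sizes ns 0, ns 1, ... are numbered consecutively.
\<close>

definition block :: "(nat \<Rightarrow> nat) \<Rightarrow> nat \<Rightarrow> nat set" where
  "block ns i = {(\<Sum>k<i. ns k)..<(\<Sum>k\<le>i. ns k)}"

text \<open>The matrix with the given blocks, all having nr rows, placed side by side.\<close>

definition block_row :: "nat \<Rightarrow> real mat list \<Rightarrow> real mat" where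
  "block_row nr Rs = mat_of_cols nr (concat (map cols Rs))"

text \<open>The type \<^typ>\<open>real vec\<close> carries no topology; convergence is componentwise.\<close>

definition vec_tendsto :: "('a \<Rightarrow> real vec) \<Rightarrow> real vec \<Rightarrow> 'a filter \<Rightarrow> bool" where
  "vec_tendsto f l F \<longleftrightarrow> (\<forall>\<^sub>F x in F. dim_vec (f x) = dim_vec l) \<and>
     (\<forall>j<dim_vec l. ((\<lambda>x. f x $ j) \<longlongrightarrow> l $ j) F)"

text \<open>Meaningful for invertible A only.\<close>

definition mat_inv :: "real mat \<Rightarrow> real mat" where
  "mat_inv A = the (mat_inverse A)"

end

theory Submission
  imports Defs "Jordan_Normal_Form.Determinant"
begin

text \<open>
  Everything is the solution of a row system \<open>x A = b\<close> whose matrix is nonsingular by a maximum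
  principle: the set on which a vector of the right kernel attains its extreme value is closed
  under the transitions.  By Cramer's rule such a solution depends continuously on A and b.
  PageRank solves \<open>v (I - c P) = (1 - c)/n\<close>.  On the transient part, \<open>w = v / (1 - c)\<close> solves
  \<open>w (I - c T) = 1/n\<close> and so converges; in particular v vanishes there in the limit.  Summing the
  equations of the block \<open>Q i\<close> and cancelling \<open>1 - c\<close> gives the mass of v on that block in terms of w.
  Finally \<open>I - Q i + J\<close>, with J the all-ones matrix, is nonsingular; \<open>v (I - c Q i + J)\<close> converges to
  the constant vector given by the limiting mass, and \<open>stationary (Q i)\<close> is the solution for the
  constant 1.
\<close>

section \<open>Row systems\<close>

text \<open>A trivial right kernel is what the maximum principle delivers; through the determinant
  it also settles the systems x A = b. The entries form a function rather than a matrix, so that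
  offsets and a factor \<open>c\<close> can be written directly.\<close>

definition nonsingular :: "nat \<Rightarrow> (nat \<Rightarrow> nat \<Rightarrow> real) \<Rightarrow> bool" where
  "nonsingular k a \<longleftrightarrow>
     (\<forall>y. (\<forall>i<k. (\<Sum>j<k. a i j * y j) = 0) \<longrightarrow> (\<forall>i<k. y i = 0))"

lemma nonsingular_cong:
  assumes "\<And>i j. i < k \<Longrightarrow> j < k \<Longrightarrow> a i j = b i j"
  shows "nonsingular k a \<longleftrightarrow> nonsingular k b"
proof -
  have "(\<Sum>j<k. a i j * y j) = (\<Sum>j<k. b i j * y j)" if "i < k" for i y
    using assms that by (intro sum.cong) auto
  then show ?thesis by (simp add: nonsingular_def)
qed

section \<open>Determinants and Cramer's rule\<close>

lemma nonsingular_imp_det_nonzero: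
  assumes "nonsingular k a"
  shows "det (mat k k (\<lambda>(i, j). a i j)) \<noteq> 0"
proof
  let ?A = "mat k k (\<lambda>(i, j). a i j)"
  assume "det ?A = 0"
  then obtain v where v: "v \<in> carrier_vec k" "v \<noteq> 0\<^sub>v k" "?A *\<^sub>v v = 0\<^sub>v k"
    using det_0_iff_vec_prod_zero_field[of ?A k] by auto
  have "(\<Sum>j<k. a i j * v $ j) = 0" if "i < k" for i
  proof -
    have "(?A *\<^sub>v v) $ i = 0" using v that by simp
    then show ?thesis
      using v(1) that by (simp add: scalar_prod_def atLeast0LessThan)
  qed
  then have "\<forall>i<k. v $ i = 0"
    using assms unfolding nonsingular_def by blast
  then have "v = 0\<^sub>v k" using v(1) by auto
  with v show False by simp
qed

lemma adj_mat_products: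
  fixes a :: "nat \<Rightarrow> nat \<Rightarrow> real" and k :: nat
  defines "A \<equiv> mat k k (\<lambda>(i, j). a i j)"
  assumes "i < k" "l < k"
  shows "(\<Sum>j<k. a i j * adj_mat A $$ (j, l)) = (if i = l then det A else 0)"
    and "(\<Sum>j<k. adj_mat A $$ (i, j) * a j l) = (if i = l then det A else 0)"
proof -
  have A: "A \<in> carrier_mat k k" by (simp add: A_def)
  note adj = adj_mat[OF A]
  have "(A * adj_mat A) $$ (i, l) = (if i = l then det A else 0)"
    unfolding adj(2) using assms by simp
  then show "(\<Sum>j<k. a i j * adj_mat A $$ (j, l)) = (if i = l then det A else 0)"
    using assms A adj(1) by (simp add: scalar_prod_def atLeast0LessThan A_def)
  have "(adj_mat A * A) $$ (i, l) = (if i = l then det A else 0)"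
    unfolding adj(3) using assms by simp
  then show "(\<Sum>j<k. adj_mat A $$ (i, j) * a j l) = (if i = l then det A else 0)"
    using assms A adj(1) by (simp add: scalar_prod_def atLeast0LessThan A_def)
qed

text \<open>Multiplying x A = b by the adjugate from the right leaves \<open>det A\<close> times x
  on the left. The form without division leaves it to each use to show that the determinant does not
  vanish.\<close>

lemma cramer_row:
  fixes a :: "nat \<Rightarrow> nat \<Rightarrow> real" and k :: nat
  defines "A \<equiv> mat k k (\<lambda>(i, j). a i j)"
  assumes x: "\<And>j. j < k \<Longrightarrow> (\<Sum>i<k. x i * a i j) = b j" and l: "l < k"
  shows "x l * det A = (\<Sum>j<k. b j * adj_mat A $$ (j, l))"
proof -
  have "(\<Sum>j<k. b j * adj_mat A $$ (j, l))
      = (\<Sum>j<k. \<Sum>i<k. x i * (a i j * adj_mat A $$ (j, l)))"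
    by (rule sum.cong) (simp_all add: x[symmetric] sum_distrib_right mult.assoc)
  also have "\<dots> = (\<Sum>i<k. x i * (\<Sum>j<k. a i j * adj_mat A $$ (j, l)))"
    by (subst sum.swap) (simp add: sum_distrib_left)
  also have "\<dots> = (\<Sum>i<k. x i * (if i = l then det A else 0))"
    using adj_mat_products(1)[of _ k l a] l by (intro sum.cong) (auto simp: A_def)
  also have "\<dots> = (\<Sum>i<k. if i = l then x i * det A else 0)"
    by (rule sum.cong) auto
  also have "\<dots> = x l * det A" using l by simp
  finally show ?thesis by simp
qed

lemma nonsingular_row_solution:
  assumes "nonsingular k a"
  shows "\<exists>x. \<forall>j<k. (\<Sum>i<k. x i * a i j) = b j"
proof (intro exI allI impI)
  let ?A = "mat k k (\<lambda>(i, j). a i j)"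
  \<comment> \<open>The candidate is b times the adjugate, divided by the determinant.\<close>
  define x where "x i = (\<Sum>l<k. b l * adj_mat ?A $$ (l, i)) / det ?A" for i
  fix j assume j: "j < k"
  have "(\<Sum>i<k. x i * a i j) = (\<Sum>i<k. \<Sum>l<k. b l * (adj_mat ?A $$ (l, i) * a i j)) / det ?A"
    by (simp add: x_def sum_distrib_right sum_divide_distrib mult.assoc)
  also have "(\<Sum>i<k. \<Sum>l<k. b l * (adj_mat ?A $$ (l, i) * a i j))
      = (\<Sum>l<k. b l * (\<Sum>i<k. adj_mat ?A $$ (l, i) * a i j))"
    by (subst sum.swap) (simp add: sum_distrib_left)
  also have "\<dots> = (\<Sum>l<k. b l * (if l = j then det ?A else 0))"
    using adj_mat_products(2)[of _ k j a] j by (intro sum.cong) auto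
  also have "\<dots> = (\<Sum>l<k. if l = j then b l * det ?A else 0)"
    by (rule sum.cong) auto
  also have "\<dots> = b j * det ?A" using j by simp
  finally show "(\<Sum>i<k. x i * a i j) = b j"
    using nonsingular_imp_det_nonzero[OF assms] by simp
qed

lemma nonsingular_row_unique:
  assumes "nonsingular k a" "l < k"
    and "\<And>j. j < k \<Longrightarrow> (\<Sum>i<k. x i * a i j) = b j"
    and "\<And>j. j < k \<Longrightarrow> (\<Sum>i<k. z i * a i j) = b j"
  shows "x l = z l"
proof -
  have "x l * det (mat k k (\<lambda>(i, j). a i j)) = z l * det (mat k k (\<lambda>(i, j). a i j))"
    by (rule trans[OF cramer_row[of k x a b l, OF assms(3,2)]
          cramer_row[of k z a b l, OF assms(4,2), symmetric]])
  then show ?thesis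
    using nonsingular_imp_det_nonzero[OF assms(1)] by simp
qed

section \<open>Continuity of determinants, adjugates and solutions\<close>

lemma tendsto_det:
  fixes A :: "'c \<Rightarrow> real mat"
  assumes "\<And>c. A c \<in> carrier_mat k k" "B \<in> carrier_mat k k"
    and "\<And>i j. i < k \<Longrightarrow> j < k \<Longrightarrow> ((\<lambda>c. A c $$ (i, j)) \<longlongrightarrow> B $$ (i, j)) F"
  shows "((\<lambda>c. det (A c)) \<longlongrightarrow> det B) F"
proof -
  \<comment> \<open>By the Leibniz formula the determinant is a polynomial in the entries.\<close>
  have "((\<lambda>c. \<Sum>q | q permutes {0..<k}. signof q * (\<Prod>i = 0..<k. A c $$ (i, q i))) \<longlongrightarrow>
        (\<Sum>q | q permutes {0..<k}. signof q * (\<Prod>i = 0..<k. B $$ (i, q i)))) F"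
  proof (intro tendsto_sum tendsto_mult tendsto_const tendsto_prod)
    fix q i assume "q \<in> {q. q permutes {0..<k}}" "i \<in> {0..<k}"
    then show "((\<lambda>c. A c $$ (i, q i)) \<longlongrightarrow> B $$ (i, q i)) F"
      using permutes_in_image[of q "{0..<k}" i] by (intro assms(3)) simp_all
  qed
  then show ?thesis
    by (simp add: det_def'[OF assms(1)] det_def'[OF assms(2)])
qed

lemma tendsto_adj_mat:
  fixes A :: "'c \<Rightarrow> real mat"
  assumes A: "\<And>c. A c \<in> carrier_mat k k" and B: "B \<in> carrier_mat k k"
    and lim: "\<And>i j. i < k \<Longrightarrow> j < k \<Longrightarrow> ((\<lambda>c. A c $$ (i, j)) \<longlongrightarrow> B $$ (i, j)) F"
    and ij: "i < k" "j < k"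
  shows "((\<lambda>c. adj_mat (A c) $$ (i, j)) \<longlongrightarrow> adj_mat B $$ (i, j)) F"
proof -
  have dim: "dim_row (A c) = k" "dim_col (A c) = k" for c
    using A[of c] by auto
  \<comment> \<open>Up to sign and transposition the entries of the adjugate are minors, again
    determinants of matrices with convergent entries.\<close>
  have "((\<lambda>c. det (mat_delete (A c) j i)) \<longlongrightarrow> det (mat_delete B j i)) F"
  proof (rule tendsto_det)
    fix r s assume "r < k - 1" "s < k - 1"
    then show "((\<lambda>c. mat_delete (A c) j i $$ (r, s)) \<longlongrightarrow> mat_delete B j i $$ (r, s)) F"
      using B by (auto simp: mat_delete_def dim intro!: lim)
  qed (use A B in \<open>auto simp: mat_delete_def dim\<close>)
  then have "((\<lambda>c. cofactor (A c) j i) \<longlongrightarrow> cofactor B j i) F"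
    unfolding cofactor_def by (intro tendsto_mult tendsto_const)
  then show ?thesis
    using B ij by (simp add: adj_mat_def dim)
qed

text \<open>Since the limit matrix is nonsingular, the determinants are eventually nonzero, and
  there Cramer's rule writes \<open>X c l\<close> as a quotient that is continuous in the data. The
  systems need to hold only eventually, which suits equations valid for
  \<open>0 < c < 1\<close>.\<close>

lemma tendsto_row_solution:
  assumes ns: "nonsingular k a"
    and a: "\<And>i j. i < k \<Longrightarrow> j < k \<Longrightarrow> ((\<lambda>c. A c i j) \<longlongrightarrow> a i j) F"
    and b: "\<And>j. j < k \<Longrightarrow> ((\<lambda>c. B c j) \<longlongrightarrow> b j) F"
    and X: "\<And>j. j < k \<Longrightarrow> \<forall>\<^sub>F c in F. (\<Sum>i<k. X c i * A c i j) = B c j"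
    and x: "\<And>j. j < k \<Longrightarrow> (\<Sum>i<k. x i * a i j) = b j"
    and l: "l < k"
  shows "((\<lambda>c. X c l) \<longlongrightarrow> x l) F"
proof -
  let ?M = "\<lambda>a :: nat \<Rightarrow> nat \<Rightarrow> real. mat k k (\<lambda>(i, j). a i j)"
  have det: "((\<lambda>c. det (?M (A c))) \<longlongrightarrow> det (?M a)) F"
    by (rule tendsto_det) (auto simp: a)
  have nz: "det (?M a) \<noteq> 0"
    by (rule nonsingular_imp_det_nonzero[OF ns])
  have "((\<lambda>c. (\<Sum>j<k. B c j * adj_mat (?M (A c)) $$ (j, l)) / det (?M (A c)))
      \<longlongrightarrow> (\<Sum>j<k. b j * adj_mat (?M a) $$ (j, l)) / det (?M a)) F"
    by (intro tendsto_divide tendsto_sum tendsto_mult b det nz tendsto_adj_mat)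
       (auto simp: a l)
  also have "(\<Sum>j<k. b j * adj_mat (?M a) $$ (j, l)) / det (?M a) = x l"
    using cramer_row[of k x a b l] x l nz by (simp add: field_simps)
  finally have lim: "((\<lambda>c. (\<Sum>j<k. B c j * adj_mat (?M (A c)) $$ (j, l)) / det (?M (A c)))
      \<longlongrightarrow> x l) F" .
  have "\<forall>\<^sub>F c in F. \<forall>j\<in>{..<k}. (\<Sum>i<k. X c i * A c i j) = B c j"
    by (rule eventually_ball_finite) (auto simp: X)
  moreover have "\<forall>\<^sub>F c in F. det (?M (A c)) \<noteq> 0"
    using tendsto_imp_eventually_ne[OF det nz] .
  ultimately have "\<forall>\<^sub>F c in F.
      (\<Sum>j<k. B c j * adj_mat (?M (A c)) $$ (j, l)) / det (?M (A c)) = X c l"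
  proof eventually_elim
    case (elim c)
    then show ?case
      using cramer_row[of k "X c" "A c" "B c" l] l by (simp add: field_simps)
  qed
  then show ?thesis
    using lim by (rule Lim_transform_eventually[rotated])
qed

section \<open>The maximum principle\<close>

lemma substochastic_argmax:
  fixes t :: "nat \<Rightarrow> real"
  assumes "\<And>j. j < k \<Longrightarrow> 0 \<le> t j" "\<And>j. j < k \<Longrightarrow> y j \<le> M"
    and "(\<Sum>j<k. t j) * M \<le> M" "M \<le> (\<Sum>j<k. t j * y j)"
    and "j < k" "0 < t j"
  shows "y j = M"
proof -
  \<comment> \<open>The weighted gaps below \<open>M\<close> are nonnegative and their sum is at
    most 0, so each of them vanishes. Bounding the total weight only after multiplication by
    \<open>M\<close> covers both weight at most 1 with \<open>M\<close> positive and weight exactly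
    1 with \<open>M\<close> of any sign.\<close>
  have nonneg: "0 \<le> t j * (M - y j)" if "j < k" for j
    using assms(1,2) that by simp
  have "(\<Sum>j<k. t j * (M - y j)) = (\<Sum>j<k. t j) * M - (\<Sum>j<k. t j * y j)"
    by (simp add: right_diff_distrib sum_subtractf sum_distrib_right)
  then have "(\<Sum>j<k. t j * (M - y j)) \<le> 0" using assms by linarith
  then have "(\<Sum>j<k. t j * (M - y j)) = 0"
    using sum_nonneg[of "{..<k}" "\<lambda>j. t j * (M - y j)"] nonneg by force
  then have "t j * (M - y j) = 0"
    using sum_nonneg_eq_0_iff[of "{..<k}" "\<lambda>j. t j * (M - y j)"] nonneg assms(5) by auto
  with assms(6) show ?thesis by simp
qed

lemma sum_diff_delta:
  fixes y :: "nat \<Rightarrow> real"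
  assumes "i < k"
  shows "(\<Sum>j<k. (of_bool (i = j) - t j) * y j) = y i - (\<Sum>j<k. t j * y j)"
    and "(\<Sum>j<k. y j * (of_bool (j = i) - t j)) = y i - (\<Sum>j<k. y j * t j)"
  using assms by (simp_all add: algebra_simps sum_subtractf)

text \<open>For y in the kernel, y = t y. If the maximum \<open>M\<close> of the absolute values
  were positive, then rows of maximisers would put weight on maximisers only. By \<open>leak\<close>
  some maximiser keeps weight less than 1 within the set of maximisers, which gives
  \<open>M < M\<close>.\<close>

lemma nonsingular_transient:
  assumes nonneg: "\<And>i j. i < k \<Longrightarrow> j < k \<Longrightarrow> 0 \<le> t i j"
    and le1: "\<And>i. i < k \<Longrightarrow> (\<Sum>j<k. t i j) \<le> 1"
    and leak: "\<And>S. S \<noteq> {} \<Longrightarrow> S \<subseteq> {..<k} \<Longrightarrow> \<exists>i\<in>S. (\<Sum>j\<in>S. t i j) < 1"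
  shows "nonsingular k (\<lambda>i j. of_bool (i = j) - t i j)"
  unfolding nonsingular_def
proof (intro allI impI, rule ccontr)
  fix y i
  assume "\<forall>i<k. (\<Sum>j<k. (of_bool (i = j) - t i j) * y j) = 0" and i: "i < k" "y i \<noteq> 0"
  then have fix_y: "y i = (\<Sum>j<k. t i j * y j)" if "i < k" for i
    using sum_diff_delta(1)[OF that, of "t i" y] that by simp
  define M where "M = Max ((\<lambda>i. \<bar>y i\<bar>) ` {..<k})"
  have fin: "finite ((\<lambda>i. \<bar>y i\<bar>) ` {..<k})" by simp
  have M: "\<bar>y j\<bar> \<le> M" if "j < k" for j
    unfolding M_def by (rule Max_ge[OF fin]) (use that in auto)
  have pos: "0 < M" using M[OF i(1)] i(2) by linarith
  have "M \<in> (\<lambda>i. \<bar>y i\<bar>) ` {..<k}"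
    unfolding M_def by (rule Max_in) (use i in auto)
  then have "{j. j < k \<and> \<bar>y j\<bar> = M} \<noteq> {}" by auto
  then obtain i where i: "i < k" "\<bar>y i\<bar> = M" "(\<Sum>j | j < k \<and> \<bar>y j\<bar> = M. t i j) < 1"
    using leak[of "{j. j < k \<and> \<bar>y j\<bar> = M}"] by auto
  \<comment> \<open>The triangle inequality passes from the fixed point equation to absolute
    values.\<close>
  have "M \<le> (\<Sum>j<k. t i j * \<bar>y j\<bar>)"
  proof -
    have "M = \<bar>\<Sum>j<k. t i j * y j\<bar>" using i fix_y by simp
    also have "\<dots> \<le> (\<Sum>j<k. \<bar>t i j * y j\<bar>)" by (rule sum_abs)
    also have "\<dots> = (\<Sum>j<k. t i j * \<bar>y j\<bar>)"
      using nonneg i by (intro sum.cong) (auto simp: abs_mult)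
    finally show ?thesis .
  qed
  moreover have "(\<Sum>j<k. t i j * \<bar>y j\<bar>) = (\<Sum>j | j < k \<and> \<bar>y j\<bar> = M. t i j) * M"
  proof -
    have "t i j = 0" if "j < k" "\<bar>y j\<bar> \<noteq> M" for j
    proof (rule ccontr)
      assume "t i j \<noteq> 0"
      then have "0 < t i j" using nonneg[OF i(1) that(1)] by simp
      then have "\<bar>y j\<bar> = M"
        using substochastic_argmax[of k "t i" "\<lambda>j. \<bar>y j\<bar>" M j] nonneg M that(1) i(1) pos le1[OF i(1)]
          \<open>M \<le> (\<Sum>j<k. t i j * \<bar>y j\<bar>)\<close>
        by simp
      with that show False by simp
    qed
    then have "(\<Sum>j<k. t i j * \<bar>y j\<bar>) = (\<Sum>j | j < k \<and> \<bar>y j\<bar> = M. t i j * \<bar>y j\<bar>)"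
      by (intro sum.mono_neutral_right) auto
    then show ?thesis by (simp add: sum_distrib_right)
  qed
  ultimately show False
    using i(3) pos by (simp add: mult_less_cancel_right_pos not_le[symmetric])
qed

text \<open>The summand 1 is the all-ones matrix, whose product with y is the constant
  \<open>s\<close>, the sum of y. So a kernel vector satisfies q y = y + s. Comparing at a maximum
  and at a minimum yields \<open>s = 0\<close>; then the maximisers form a closed set, so y is
  constant, and its sum being 0 makes it vanish.\<close>

lemma nonsingular_irreducible:
  assumes nonneg: "\<And>i j. i < k \<Longrightarrow> j < k \<Longrightarrow> 0 \<le> q i j"
    and eq1: "\<And>i. i < k \<Longrightarrow> (\<Sum>j<k. q i j) = 1"
    and irred: "\<And>S. S \<noteq> {} \<Longrightarrow> S \<subseteq> {..<k} \<Longrightarrow>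
      \<forall>i\<in>S. \<forall>j<k. q i j > 0 \<longrightarrow> j \<in> S \<Longrightarrow> S = {..<k}"
  shows "nonsingular k (\<lambda>i j. of_bool (i = j) - q i j + 1)"
  unfolding nonsingular_def
proof (intro allI impI)
  fix y i0
  assume y0: "\<forall>i<k. (\<Sum>j<k. (of_bool (i = j) - q i j + 1) * y j) = 0" and i0: "i0 < k"
  define s where "s = (\<Sum>j<k. y j)"
  have fix_y: "(\<Sum>j<k. q i j * y j) = y i + s" if "i < k" for i
  proof -
    have "(\<Sum>j<k. (of_bool (i = j) - q i j + 1) * y j)
        = (\<Sum>j<k. (of_bool (i = j) - q i j) * y j) + s"
      unfolding s_def sum.distrib[symmetric] by (simp add: distrib_right)
    then show ?thesis
      using y0 sum_diff_delta(1)[OF that, of "q i" y] that by simp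
  qed
  have fin: "finite (y ` {..<k})" and ne: "y ` {..<k} \<noteq> {}" using i0 by auto
  define M where "M = Max (y ` {..<k})"
  obtain i1 where i1: "i1 < k" "y i1 = Min (y ` {..<k})"
    using Min_in[OF fin ne] by auto
  obtain i2 where i2: "i2 < k" "y i2 = M"
    using Max_in[OF fin ne] by (auto simp: M_def)
  have max: "y j \<le> M" and min: "y i1 \<le> y j" if "j < k" for j
    using that Max_ge[OF fin] Min_le[OF fin] by (auto simp: M_def i1(2))
  \<comment> \<open>The weighted average at \<open>i2\<close> cannot exceed the maximum, hence
    \<open>s \<le> 0\<close>; the minimum at \<open>i1\<close> gives the reverse bound.\<close>
  have "y i2 + s \<le> (\<Sum>j<k. q i2 j * M)"
    unfolding fix_y[OF i2(1), symmetric]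
    by (intro sum_mono mult_left_mono nonneg max) (auto simp: i2)
  then have "s \<le> 0"
    using i2 eq1[OF i2(1)] by (simp flip: sum_distrib_right)
  moreover have "(\<Sum>j<k. q i1 j * y i1) \<le> y i1 + s"
    unfolding fix_y[OF i1(1), symmetric]
    by (intro sum_mono mult_left_mono nonneg min) (auto simp: i1)
  then have "s \<ge> 0"
    using eq1[OF i1(1)] by (simp flip: sum_distrib_right)
  ultimately have s: "s = 0" by simp
  have "{j. j < k \<and> y j = M} = {..<k}"
  proof (rule irred)
    show "\<forall>i\<in>{j. j < k \<and> y j = M}. \<forall>j<k. 0 < q i j \<longrightarrow> j \<in> {j. j < k \<and> y j = M}"
    proof (intro ballI allI impI)
      fix i j assume *: "i \<in> {j. j < k \<and> y j = M}" "j < k" "0 < q i j"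
      then have "y j = M"
        using substochastic_argmax[of k "q i" y M j] nonneg max eq1 fix_y s by auto
      with * show "j \<in> {j. j < k \<and> y j = M}" by simp
    qed
  qed (use i2 in auto)
  then have const: "y j = M" if "j < k" for j using that by blast
  have "s = real k * M" unfolding s_def using const by simp
  then show "y i0 = 0" using const i0 s by simp
qed

lemma nonsingular_ex1_vec:
  assumes "nonsingular k a"
  shows "\<exists>!v. v \<in> carrier_vec k \<and> (\<forall>j<k. (\<Sum>i<k. v $ i * a i j) = b j)"
proof -
  obtain x where x: "\<And>j. j < k \<Longrightarrow> (\<Sum>i<k. x i * a i j) = b j"
    using nonsingular_row_solution[OF assms, of b] by blast
  show ?thesis
  proof (rule ex1I[of _ "vec k x"])
    fix v assume v: "v \<in> carrier_vec k \<and> (\<forall>j<k. (\<Sum>i<k. v $ i * a i j) = b j)"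
    show "v = vec k x"
    proof (rule eq_vecI)
      fix i assume "i < dim_vec (vec k x)"
      then have "i < k" by simp
      then have "v $ i = x i"
        using v x by (intro nonsingular_row_unique[OF assms, of i "\<lambda>i. v $ i" b x]) auto
      then show "v $ i = vec k x $ i" using \<open>i < k\<close> by simp
    qed (use v in auto)
  qed (use x in auto)
qed

section \<open>Stationary vectors as solutions of row systems\<close>

lemma is_stationary_iff:
  assumes "A \<in> carrier_mat k k"
  shows "is_stationary A v \<longleftrightarrow> v \<in> carrier_vec k \<and>
    (\<forall>j<k. (\<Sum>i<k. v $ i * A $$ (i, j)) = v $ j) \<and> (\<Sum>i<k. v $ i) = 1"
proof (cases "v \<in> carrier_vec k")
  case True
  then have dims: "dim_row A = k" "dim_col A = k" "dim_vec v = k" using assms by auto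
  have "(mat_of_row v * A) $$ (0, j) = (\<Sum>i<k. v $ i * A $$ (i, j))" if "j < k" for j
    using that dims by (simp add: scalar_prod_def atLeast0LessThan)
  moreover have "mat_of_row v * A = mat_of_row v \<longleftrightarrow>
      (\<forall>j<k. (mat_of_row v * A) $$ (0, j) = mat_of_row v $$ (0, j))"
    using dims by (auto simp: mat_eq_iff)
  moreover have "v \<bullet> ones_vec k = (\<Sum>i<k. v $ i)"
    by (simp add: scalar_prod_def ones_vec_def atLeast0LessThan)
  ultimately show ?thesis
    using True dims by (auto simp: is_stationary_def)
qed (use assms in \<open>auto simp: is_stationary_def\<close>)

text \<open>This is x (q 1) = s (x 1), used to add up all equations of a row system.\<close>

lemma sum_stochastic_row:
  fixes q :: "nat \<Rightarrow> nat \<Rightarrow> real"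
  assumes "\<And>i. i < k \<Longrightarrow> (\<Sum>j<k. q i j) = s"
  shows "(\<Sum>j<k. \<Sum>i<k. x i * q i j) = (\<Sum>i<k. x i) * s"
proof -
  have "(\<Sum>j<k. \<Sum>i<k. x i * q i j) = (\<Sum>i<k. x i * (\<Sum>j<k. q i j))"
    by (subst sum.swap) (simp add: sum_distrib_left)
  then show ?thesis by (simp add: assms sum_distrib_right)
qed

text \<open>For total mass 1 the uniform part of the Google matrix contributes the constant
  \<open>(1 - c) / n\<close>. Conversely, adding all equations of the row system gives
  \<open>1 - c\<close> times the total mass equal to \<open>1 - c\<close>, so the normalisation is
  implicit.\<close>

lemma is_stationary_google_iff:
  assumes P: "P \<in> carrier_mat n n" and n: "0 < n" and c: "c \<noteq> 1"
    and rows: "\<And>i. i < n \<Longrightarrow> (\<Sum>j<n. P $$ (i, j)) = 1"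
  shows "is_stationary (google_matrix P c) v \<longleftrightarrow> v \<in> carrier_vec n \<and>
    (\<forall>j<n. (\<Sum>i<n. v $ i * (of_bool (i = j) - c * P $$ (i, j))) = (1 - c) / real n)"
proof -
  have G: "google_matrix P c \<in> carrier_mat n n"
    using P by (simp add: google_matrix_def Let_def)
  have G_index: "google_matrix P c $$ (i, j) = c * P $$ (i, j) + (1 - c) / real n"
    if "i < n" "j < n" for i j
    using P that by (simp add: google_matrix_def Let_def)
  have expand: "(\<Sum>i<n. v $ i * google_matrix P c $$ (i, j))
      = (\<Sum>i<n. v $ i * (c * P $$ (i, j))) + (\<Sum>i<n. v $ i) * ((1 - c) / real n)" if "j < n" for j
    using that by (simp add: G_index distrib_left sum.distrib sum_distrib_right sum_divide_distrib)
  have split: "(\<Sum>i<n. v $ i * (of_bool (i = j) - c * P $$ (i, j)))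
      = v $ j - (\<Sum>i<n. v $ i * (c * P $$ (i, j)))" if "j < n" for j
    using sum_diff_delta(2)[OF that] .
  have "(\<Sum>i<n. v $ i) = 1"
    if *: "\<forall>j<n. (\<Sum>i<n. v $ i * (of_bool (i = j) - c * P $$ (i, j))) = (1 - c) / real n"
  proof -
    have "(\<Sum>j<n. of_bool (i = j) - c * P $$ (i, j)) = 1 - c" if "i < n" for i
      using that rows[OF that] by (simp add: sum_subtractf flip: sum_distrib_left)
    then have "(\<Sum>j<n. \<Sum>i<n. v $ i * (of_bool (i = j) - c * P $$ (i, j)))
        = (\<Sum>i<n. v $ i) * (1 - c)"
      by (rule sum_stochastic_row)
    moreover have "(\<Sum>j<n. \<Sum>i<n. v $ i * (of_bool (i = j) - c * P $$ (i, j))) = 1 - c"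
      using * n by simp
    ultimately show ?thesis using c by simp
  qed
  moreover have "(\<Sum>i<n. v $ i * google_matrix P c $$ (i, j)) = v $ j \<longleftrightarrow>
      (\<Sum>i<n. v $ i * (of_bool (i = j) - c * P $$ (i, j))) = (1 - c) / real n"
    if "j < n" "(\<Sum>i<n. v $ i) = 1" for j
    using split[OF that(1)] expand[OF that(1)] that(2) by auto
  ultimately show ?thesis
    unfolding is_stationary_iff[OF G] by blast
qed

text \<open>Adding the all-ones matrix absorbs the normalisation: the sum of all equations is
  \<open>k\<close> times the mass equal to \<open>k\<close>, and with mass 1 the rest is v Q =
  v.\<close>

lemma is_stationary_irreducible_iff:
  assumes Q: "Q \<in> carrier_mat k k" and k: "0 < k"
    and rows: "\<And>i. i < k \<Longrightarrow> (\<Sum>j<k. Q $$ (i, j)) = 1"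
  shows "is_stationary Q v \<longleftrightarrow> v \<in> carrier_vec k \<and>
    (\<forall>j<k. (\<Sum>i<k. v $ i * (of_bool (i = j) - Q $$ (i, j) + 1)) = 1)"
proof -
  have expand: "(\<Sum>i<k. v $ i * (of_bool (i = j) - Q $$ (i, j) + 1))
      = v $ j - (\<Sum>i<k. v $ i * Q $$ (i, j)) + (\<Sum>i<k. v $ i)" if "j < k" for j
    using sum_diff_delta(2)[OF that, of "\<lambda>i. v $ i" "\<lambda>i. Q $$ (i, j)"]
    by (simp add: distrib_left sum.distrib)
  have "(\<Sum>i<k. v $ i) = 1"
    if *: "\<forall>j<k. (\<Sum>i<k. v $ i * (of_bool (i = j) - Q $$ (i, j) + 1)) = 1"
  proof -
    have "(\<Sum>j<k. of_bool (i = j) - Q $$ (i, j) + 1) = real k" if "i < k" for i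
      using that rows[OF that] by (simp add: sum_subtractf sum.distrib)
    then have "(\<Sum>j<k. \<Sum>i<k. v $ i * (of_bool (i = j) - Q $$ (i, j) + 1))
        = (\<Sum>i<k. v $ i) * real k"
      by (rule sum_stochastic_row)
    moreover have "(\<Sum>j<k. \<Sum>i<k. v $ i * (of_bool (i = j) - Q $$ (i, j) + 1)) = real k"
      using * by simp
    ultimately show ?thesis using k by simp
  qed
  then show ?thesis
    unfolding is_stationary_iff[OF Q] using expand by auto
qed

section \<open>Positions in block matrices\<close>

lemma dim_diag_block_mat_upt:
  assumes "\<And>i. i < m \<Longrightarrow> Q i \<in> carrier_mat (ns i) (ns i)"
  shows "dim_row (diag_block_mat (map Q [0..<m])) = (\<Sum>k<m. ns k)"
    and "dim_col (diag_block_mat (map Q [0..<m])) = (\<Sum>k<m. ns k)"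
  using assms
  by (induction m) (auto simp: diag_block_mat_append Let_def)

lemma sum_offset_bound:
  fixes ns :: "nat \<Rightarrow> nat"
  assumes "i < m" "a < ns i"
  shows "(\<Sum>k<i. ns k) + a < (\<Sum>k<m. ns k)"
proof -
  have "(\<Sum>k<Suc i. ns k) \<le> (\<Sum>k<m. ns k)"
    using assms by (intro sum_mono2) auto
  with assms show ?thesis by simp
qed

lemma diag_block_mat_index:
  assumes "\<And>i. i < m \<Longrightarrow> Q i \<in> carrier_mat (ns i) (ns i)" "i < m" "a < ns i" "b < ns i"
  shows "diag_block_mat (map Q [0..<m]) $$ ((\<Sum>k<i. ns k) + a, (\<Sum>k<i. ns k) + b) = Q i $$ (a, b)"
  using assms
proof (induction m)
  case (Suc m)
  have dims: "dim_row (diag_block_mat (map Q [0..<m])) = (\<Sum>k<m. ns k)"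
    "dim_col (diag_block_mat (map Q [0..<m])) = (\<Sum>k<m. ns k)"
    "dim_row (Q m) = ns m" "dim_col (Q m) = ns m"
    using dim_diag_block_mat_upt[of m Q ns] Suc.prems(1) by force+
  show ?case
  proof (cases "i = m")
    case True
    then show ?thesis
      using Suc.prems dims by (simp add: diag_block_mat_append Let_def)
  next
    case False
    then have "i < m" using Suc.prems by simp
    moreover have "(\<Sum>k<i. ns k) + a < (\<Sum>k<m. ns k)" "(\<Sum>k<i. ns k) + b < (\<Sum>k<m. ns k)"
      using \<open>i < m\<close> Suc.prems sum_offset_bound by blast+
    ultimately show ?thesis
      using Suc dims by (simp add: diag_block_mat_append Let_def)
  qed
qed simp

text \<open>\<open>block_row\<close> concatenates lists of columns, so finding one of its entries
  comes down to finding a position in a concatenation.\<close>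

lemma concat_upt_nth:
  assumes "\<And>i. i < m \<Longrightarrow> length (f i) = ns i" "i < m" "b < ns i"
  shows "concat (map f [0..<m]) ! ((\<Sum>k<i. ns k) + b) = f i ! b"
  using assms
proof (induction m)
  case (Suc m)
  have len: "length (concat (map f [0..<m])) = (\<Sum>k<m. ns k)"
    using Suc.prems(1) by (simp add: length_concat interv_sum_list_conv_sum_set_nat atLeast0LessThan)
  show ?case
  proof (cases "i = m")
    case True
    then show ?thesis using len by (simp add: nth_append)
  next
    case False
    then have "i < m" using Suc.prems by simp
    then show ?thesis
      using Suc len sum_offset_bound[of i m b ns] by (simp add: nth_append)
  qed
qed simp

lemma block_row_index:
  assumes "\<And>i. i < m \<Longrightarrow> R i \<in> carrier_mat nr (ns i)" "i < m" "a < nr" "b < ns i"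
  shows "block_row nr (map R [0..<m]) $$ (a, (\<Sum>k<i. ns k) + b) = R i $$ (a, b)"
proof -
  have len: "length (cols (R i)) = ns i" if "i < m" for i
    using assms(1)[OF that] by simp
  have "length (concat (map (\<lambda>i. cols (R i)) [0..<m])) = (\<Sum>k<m. ns k)"
    using len by (simp add: length_concat interv_sum_list_conv_sum_set_nat atLeast0LessThan)
  moreover have "concat (map (\<lambda>i. cols (R i)) [0..<m]) ! ((\<Sum>k<i. ns k) + b) = col (R i) b"
    using concat_upt_nth[of m "\<lambda>i. cols (R i)" ns i b] assms(1)[OF assms(2)] len assms(2,4)
    by simp
  ultimately show ?thesis
    using assms(1)[OF assms(2)] assms(2-4) sum_offset_bound[of i m b ns]
    by (simp add: block_row_def mat_of_cols_def comp_def)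
qed

lemma dim_foldr_append_vec:
  assumes "\<And>i. i < m \<Longrightarrow> dim_vec (f i) = ns i"
  shows "dim_vec (foldr (@\<^sub>v) (map f [0..<m]) z) = (\<Sum>k<m. ns k) + dim_vec z"
  using assms by (induction m arbitrary: z) auto

text \<open>Removing the last block from the list appends it in front of \<open>z\<close>, so the
  induction must let the tail and the position in it vary.\<close>

lemma foldr_append_vec_index_last:
  assumes "\<And>i. i < m \<Longrightarrow> dim_vec (f i) = ns i" "a < dim_vec z"
  shows "foldr (@\<^sub>v) (map f [0..<m]) z $ ((\<Sum>k<m. ns k) + a) = z $ a"
  using assms
proof (induction m arbitrary: z a)
  case (Suc m)
  then have "foldr (@\<^sub>v) (map f [0..<m]) (f m @\<^sub>v z) $ ((\<Sum>k<m. ns k) + (ns m + a))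
      = (f m @\<^sub>v z) $ (ns m + a)"
    by (intro Suc.IH) auto
  with Suc.prems show ?case by (simp add: add.assoc)
qed simp

lemma foldr_append_vec_index:
  assumes "\<And>i. i < m \<Longrightarrow> dim_vec (f i) = ns i" "i < m" "a < ns i"
  shows "foldr (@\<^sub>v) (map f [0..<m]) z $ ((\<Sum>k<i. ns k) + a) = f i $ a"
  using assms
proof (induction m arbitrary: z)
  case (Suc m)
  show ?case
  proof (cases "i = m")
    case True
    then show ?thesis
      using foldr_append_vec_index_last[of m f ns a "f m @\<^sub>v z"] Suc.prems by simp
  next
    case False
    then show ?thesis using Suc by simp
  qed
qed simp

lemma sum_split_blocks:
  fixes f :: "nat \<Rightarrow> real" and ns :: "nat \<Rightarrow> nat"
  shows "(\<Sum>i<(\<Sum>k<m. ns k) + r. f i)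
      = (\<Sum>k<m. \<Sum>a<ns k. f ((\<Sum>l<k. ns l) + a)) + (\<Sum>a<r. f ((\<Sum>k<m. ns k) + a))"
proof -
  have split: "(\<Sum>i<s + r. f i) = (\<Sum>i<s. f i) + (\<Sum>a<r. f (s + a))" for s r :: nat
    by (induction r) auto
  have "(\<Sum>i<(\<Sum>k<m. ns k). f i) = (\<Sum>k<m. \<Sum>a<ns k. f ((\<Sum>l<k. ns l) + a))"
    by (induction m) (simp_all add: split)
  then show ?thesis by (simp add: split)
qed

section \<open>Closed components\<close>

lemma pair_fin_digraph_matrix_graph:
  assumes "A \<in> carrier_mat n n"
  shows "pair_fin_digraph (matrix_graph A)"
proof
  have "parcs (matrix_graph A) \<subseteq> {..<n} \<times> {..<n}"
    using assms by (auto simp: matrix_graph_def)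
  then show "finite (parcs (matrix_graph A))"
    by (rule finite_subset) simp
qed (use assms in \<open>auto simp: matrix_graph_def\<close>)

lemma closed_set_iff:
  assumes "A \<in> carrier_mat n n" "S \<subseteq> {..<n}"
  shows "closed_set A S \<longleftrightarrow> (\<forall>i\<in>S. \<forall>j<n. A $$ (i, j) > 0 \<longrightarrow> j \<in> S)"
  using assms by (fastforce simp: closed_set_def matrix_graph_def)

lemma closed_set_reachable:
  assumes "closed_set A S" "u \<in> S" "u \<rightarrow>\<^sup>*\<^bsub>with_proj (matrix_graph A)\<^esub> v"
  shows "v \<in> S"
proof -
  have "(u, v) \<in> rtrancl_on (pverts (matrix_graph A)) (parcs (matrix_graph A))"
    using assms(3) by (simp add: reachable_def)
  then show ?thesis
    using assms(1,2) by (induction rule: rtrancl_on_induct) (auto simp: closed_set_def)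
qed

lemma scc_sets_subset:
  assumes "A \<in> carrier_mat n n" "S \<in> scc_sets A"
  shows "S \<subseteq> {..<n}"
proof -
  interpret pair_fin_digraph "matrix_graph A"
    by (rule pair_fin_digraph_matrix_graph[OF assms(1)])
  show ?thesis
    using sccs_verts_subsets[of S] assms by (auto simp: scc_sets_def matrix_graph_def)
qed

text \<open>Every node of \<open>S\<close> is reachable from a node of \<open>C\<close>, and paths
  do not leave a closed set. This supplies the irreducibility that the maximum principle asks
  for.\<close>

lemma closed_subset_scc_eq:
  assumes "S \<in> scc_sets A" "C \<noteq> {}" "C \<subseteq> S" "closed_set A C"
  shows "C = S"
proof -
  obtain u where "u \<in> C" using assms by blast
  then have "u \<rightarrow>\<^sup>*\<^bsub>with_proj (matrix_graph A)\<^esub> v" if "v \<in> S" for v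
    using assms(1,3) that unfolding scc_sets_def pre_digraph.sccs_verts_def by blast
  with \<open>u \<in> C\<close> have "S \<subseteq> C"
    using closed_set_reachable[OF assms(4)] by blast
  with assms(3) show ?thesis by blast
qed

text \<open>Among the nodes reachable from \<open>u\<close>, choose \<open>v\<close> with the fewest
  reachable nodes. Whatever \<open>v\<close> reaches has, by minimality, the same reachable set and
  so leads back to \<open>v\<close>. Hence the reachable set of \<open>v\<close> is a strongly
  connected component, and it is closed.\<close>

lemma exists_closed_scc:
  assumes A: "A \<in> carrier_mat n n" and u: "u < n"
  obtains S where "S \<in> scc_sets A" "closed_set A S"
    "\<And>v. v \<in> S \<Longrightarrow> u \<rightarrow>\<^sup>*\<^bsub>with_proj (matrix_graph A)\<^esub> v"
proof -
  let ?G = "with_proj (matrix_graph A)"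
  interpret pair_fin_digraph "matrix_graph A"
    by (rule pair_fin_digraph_matrix_graph[OF A])
  have verts: "pverts (matrix_graph A) = {..<n}"
    using A by (simp add: matrix_graph_def)
  define r where "r x = {v. x \<rightarrow>\<^sup>*\<^bsub>?G\<^esub> v}" for x
  have fin: "finite (r x)" for x
  proof -
    have "r x \<subseteq> {..<n}" using reachable_in_verts verts by (auto simp: r_def)
    then show ?thesis by (rule finite_subset) simp
  qed
  have u_self: "u \<in> r u" using u verts by (simp add: r_def)
  define v where "v = arg_min (\<lambda>v. card (r v)) (\<lambda>v. v \<in> r u)"
  have v: "v \<in> r u" unfolding v_def using u_self by (rule arg_min_natI)
  have v_min: "card (r v) \<le> card (r w)" if "w \<in> r u" for w
    unfolding v_def by (rule arg_min_nat_le[of "\<lambda>v. v \<in> r u", OF that])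
  have mono: "r w \<subseteq> r x" if "w \<in> r x" for w x
    using that reachable_trans unfolding r_def by blast
  have mutual: "v \<in> r w" if "w \<in> r v" for w
  proof -
    have "r w = r v"
      using mono[OF that] v_min[of w] mono[OF v] that by (intro card_seteq fin) auto
    moreover have "v \<in> r v"
      using v reachable_in_verts by (auto simp: r_def)
    ultimately show ?thesis by simp
  qed
  show thesis
  proof (rule that)
    have "v \<in> r v" using v reachable_in_verts by (auto simp: r_def)
    then show "r v \<in> scc_sets A"
      unfolding scc_sets_def in_sccs_verts_conv_reachable
      using mutual reachable_trans unfolding r_def by blast
    show "closed_set A (r v)"
      unfolding closed_set_def r_def
      using reachable_adj_trans by blast
    show "u \<rightarrow>\<^sup>*\<^bsub>?G\<^esub> w" if "w \<in> r v" for w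
      using that mono[OF v] by (auto simp: r_def)
  qed
qed

section \<open>The hyperlink matrix\<close>

lemma hyperlink_matrix_carrier: "hyperlink_matrix n W \<in> carrier_mat n n"
  by (simp add: hyperlink_matrix_def)

lemma hyperlink_matrix_nonneg: "i < n \<Longrightarrow> j < n \<Longrightarrow> 0 \<le> hyperlink_matrix n W $$ (i, j)"
  by (simp add: hyperlink_matrix_def)

lemma hyperlink_matrix_row_sum:
  assumes "pair_fin_digraph W" "pverts W = {..<n}" "i < n"
  shows "(\<Sum>j<n. hyperlink_matrix n W $$ (i, j)) = 1"
proof (cases "i \<in> dangling_pages W")
  case True
  then show ?thesis using assms(3) by (simp add: hyperlink_matrix_def)
next
  case False
  interpret pair_fin_digraph W by fact
  let ?d = "out_degree (with_proj W) i"
  have d: "?d \<noteq> 0" using False assms by (simp add: dangling_pages_def)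
  \<comment> \<open>Arcs are pairs, so the arcs leaving \<open>i\<close> correspond to their
    targets, and the out-degree counts the positive entries of the row.\<close>
  have "out_arcs (with_proj W) i = Pair i ` {j. j < n \<and> (i, j) \<in> parcs W}"
    using in_arcsD2 assms(2) by (auto simp: out_arcs_def)
  then have "?d = card {j. j < n \<and> (i, j) \<in> parcs W}"
    unfolding out_degree_def by (simp add: card_image inj_on_def)
  moreover have "(\<Sum>j<n. hyperlink_matrix n W $$ (i, j))
      = (\<Sum>j | j < n \<and> (i, j) \<in> parcs W. 1 / real ?d)"
    using False assms(3)
    by (intro sum.mono_neutral_cong_right) (auto simp: hyperlink_matrix_def)
  ultimately show ?thesis using d by simp
qed

text \<open>The row of a dangling page is positive everywhere.\<close>

lemma dangling_closed_set:
  assumes "d \<in> dangling_pages W" "d \<in> S" "pverts W = {..<n}" "S \<subseteq> {..<n}"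
    "closed_set (hyperlink_matrix n W) S"
  shows "S = {..<n}"
proof -
  have "d < n" using assms(1,3) by (simp add: dangling_pages_def)
  then have "hyperlink_matrix n W $$ (d, j) > 0" if "j < n" for j
    using assms(1) that by (simp add: hyperlink_matrix_def)
  then have "j \<in> S" if "j < n" for j
    using closed_set_iff[OF hyperlink_matrix_carrier assms(4)] assms(2,5) that by blast
  with assms(4) show ?thesis by blast
qed

text \<open>The definite description in \<open>ESCC\<close> is justified: dangling pages are
  pairwise adjacent, hence in one component, and distinct components are disjoint.\<close>

lemma ESCC_scc:
  assumes V: "pverts W = {..<n}" and d: "dangling_pages W \<noteq> {}"
  shows "ESCC n W \<in> scc_sets (hyperlink_matrix n W)" "dangling_pages W \<subseteq> ESCC n W"
proof -
  let ?P = "hyperlink_matrix n W"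
  interpret pair_fin_digraph "matrix_graph ?P"
    by (rule pair_fin_digraph_matrix_graph[OF hyperlink_matrix_carrier])
  obtain d where d: "d \<in> dangling_pages W" using assms(2) by blast
  have verts: "pverts (matrix_graph ?P) = {..<n}"
    by (simp add: matrix_graph_def hyperlink_matrix_def)
  have arcs: "(e, f) \<in> parcs (matrix_graph ?P)"
    if "e \<in> dangling_pages W" "f \<in> dangling_pages W" for e f
    using that V by (auto simp: matrix_graph_def hyperlink_matrix_def dangling_pages_def)
  have "d \<in> pverts (matrix_graph ?P)" using d V verts by (simp add: dangling_pages_def)
  then have "scc_of d \<in> scc_sets ?P"
    unfolding scc_sets_def by (rule scc_of_in_sccs_verts)
  moreover have "dangling_pages W \<subseteq> scc_of d"
    using arcs d by (auto simp: scc_of_def)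
  ultimately have "\<exists>!S. S \<in> scc_sets ?P \<and> dangling_pages W \<subseteq> S"
    using d sccs_verts_disjoint unfolding scc_sets_def by blast
  then show "ESCC n W \<in> scc_sets ?P" "dangling_pages W \<subseteq> ESCC n W"
    unfolding ESCC_def by (metis (mono_tags, lifting) theI')+
qed

text \<open>A closed component reachable from \<open>u\<close> always exists. Were it the ESCC, it
  would contain a dangling page and so be everything, leaving Pure OUT empty. It is therefore
  disjoint from the ESCC. This is the reason why mass leaks out of the transient block.\<close>

lemma absorbing_component_reachable:
  assumes V: "pverts W = {..<n}" and dangling: "dangling_pages W \<noteq> {}"
    and pure: "pure_OUT n W \<noteq> {}" and u: "u < n"
  obtains S where "S \<in> scc_sets (hyperlink_matrix n W)" "closed_set (hyperlink_matrix n W) S"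
    "S \<subseteq> pure_OUT n W" "\<And>v. v \<in> S \<Longrightarrow> u \<rightarrow>\<^sup>*\<^bsub>with_proj (matrix_graph (hyperlink_matrix n W))\<^esub> v"
proof -
  let ?P = "hyperlink_matrix n W"
  interpret pair_fin_digraph "matrix_graph ?P"
    by (rule pair_fin_digraph_matrix_graph[OF hyperlink_matrix_carrier])
  obtain S where S: "S \<in> scc_sets ?P" "closed_set ?P S"
    "\<And>v. v \<in> S \<Longrightarrow> u \<rightarrow>\<^sup>*\<^bsub>with_proj (matrix_graph ?P)\<^esub> v"
    using exists_closed_scc[OF hyperlink_matrix_carrier u] by blast
  have sub: "S \<subseteq> {..<n}" by (rule scc_sets_subset[OF hyperlink_matrix_carrier S(1)])
  have "S \<noteq> ESCC n W"
  proof
    assume "S = ESCC n W"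
    then have "S = {..<n}"
      using ESCC_scc[OF V dangling] dangling dangling_closed_set[OF _ _ V sub S(2)] by blast
    with \<open>S = ESCC n W\<close> pure V show False by (simp add: pure_OUT_def)
  qed
  then have "S \<inter> ESCC n W = {}"
    using S(1) ESCC_scc(1)[OF V dangling] sccs_verts_disjoint unfolding scc_sets_def by blast
  then have "S \<subseteq> pure_OUT n W" using sub V by (auto simp: pure_OUT_def)
  with S that show thesis by blast
qed

section \<open>The limit of PageRank\<close>

lemma sum_offset_disjoint:
  fixes ns :: "nat \<Rightarrow> nat"
  assumes "i \<noteq> k" "b < ns i" "(\<Sum>l<k. ns l) \<le> (\<Sum>l<i. ns l) + b"
  shows "(\<Sum>l<k. ns l) + ns k \<le> (\<Sum>l<i. ns l) + b"
proof (cases "k < i")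
  case True
  then have "(\<Sum>l<Suc k. ns l) \<le> (\<Sum>l<i. ns l)"
    by (intro sum_mono2) auto
  then show ?thesis by simp
next
  case False
  then have "i < k" using assms(1) by simp
  then show ?thesis using sum_offset_bound[of i k b ns] assms by simp
qed

lemma sum_offset_cover:
  fixes ns :: "nat \<Rightarrow> nat"
  assumes "j < (\<Sum>k<m. ns k)"
  obtains i a where "i < m" "a < ns i" "j = (\<Sum>k<i. ns k) + a"
  using assms
proof (induction m arbitrary: thesis)
  case (Suc m)
  show ?case
  proof (cases "j < (\<Sum>k<m. ns k)")
    case True
    then show ?thesis using Suc.IH Suc.prems(1) less_Suc_eq by metis
  next
    case False
    then show ?thesis
      using Suc.prems(2) by (intro Suc.prems(1)[of m "j - (\<Sum>k<m. ns k)"]) auto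
  qed
qed simp

lemma eventually_unit_interval:
  "(\<And>c. 0 < c \<Longrightarrow> c < 1 \<Longrightarrow> \<Phi> c) \<Longrightarrow> \<forall>\<^sub>F c in at 1 within {0<..<1 :: real}. \<Phi> c"
  by (auto simp: eventually_at_topological)

text \<open>The matrix reduced to its entries, with block \<open>k\<close> starting at the sum of
  the earlier sizes and the transient positions last. \<open>irreducible\<close> and
  \<open>transient\<close> have the form in which the two nonsingularity lemmas use them.\<close>

locale absorbing_chain =
  fixes n m nT :: nat and ns :: "nat \<Rightarrow> nat" and p :: "nat \<Rightarrow> nat \<Rightarrow> real"
  assumes size: "n = (\<Sum>k<m. ns k) + nT"
    and nonneg: "\<And>i j. i < n \<Longrightarrow> j < n \<Longrightarrow> 0 \<le> p i j"
    and row_sum: "\<And>i. i < n \<Longrightarrow> (\<Sum>j<n. p i j) = 1"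
    and closed: "\<And>i a j. i < m \<Longrightarrow> a < ns i \<Longrightarrow> j < n \<Longrightarrow> p ((\<Sum>k<i. ns k) + a) j \<noteq> 0 \<Longrightarrow>
      (\<Sum>k<i. ns k) \<le> j \<and> j < (\<Sum>k<i. ns k) + ns i"
    and irreducible: "\<And>i S. i < m \<Longrightarrow> S \<noteq> {} \<Longrightarrow> S \<subseteq> {..<ns i} \<Longrightarrow>
      \<forall>a\<in>S. \<forall>b<ns i. p ((\<Sum>k<i. ns k) + a) ((\<Sum>k<i. ns k) + b) > 0 \<longrightarrow> b \<in> S \<Longrightarrow> S = {..<ns i}"
    and transient: "\<And>S. S \<noteq> {} \<Longrightarrow> S \<subseteq> {..<nT} \<Longrightarrow>
      \<exists>a\<in>S. (\<Sum>b\<in>S. p ((\<Sum>k<m. ns k) + a) ((\<Sum>k<m. ns k) + b)) < 1"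
begin

abbreviation off :: "nat \<Rightarrow> nat" where "off i \<equiv> \<Sum>k<i. ns k"
abbreviation q :: "nat \<Rightarrow> nat \<Rightarrow> nat \<Rightarrow> real" where "q i a b \<equiv> p (off i + a) (off i + b)"
abbreviation r :: "nat \<Rightarrow> nat \<Rightarrow> nat \<Rightarrow> real" where "r i a b \<equiv> p (off m + a) (off i + b)"
abbreviation t :: "nat \<Rightarrow> nat \<Rightarrow> real" where "t a b \<equiv> p (off m + a) (off m + b)"

lemma off_less: "i < m \<Longrightarrow> a < ns i \<Longrightarrow> off i + a < off m"
  by (rule sum_offset_bound)

lemma block_less: "i < m \<Longrightarrow> a < ns i \<Longrightarrow> off i + a < n"
  using off_less[of i a] size by linarith

lemma q_row_sum:
  assumes "i < m" "a < ns i"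
  shows "(\<Sum>b<ns i. q i a b) = 1"
proof -
  \<comment> \<open>By \<open>closed\<close> the whole mass of the row lies in its own
    block.\<close>
  have "(\<Sum>j<n. p (off i + a) j) = (\<Sum>j\<in>(+) (off i) ` {..<ns i}. p (off i + a) j)"
  proof (rule sum.mono_neutral_right)
    show "(+) (off i) ` {..<ns i} \<subseteq> {..<n}" using block_less assms by auto
    show "\<forall>j\<in>{..<n} - (+) (off i) ` {..<ns i}. p (off i + a) j = 0"
    proof (rule ballI, rule ccontr)
      fix j assume j: "j \<in> {..<n} - (+) (off i) ` {..<ns i}" "p (off i + a) j \<noteq> 0"
      then have "off i \<le> j" "j < off i + ns i" using closed[OF assms] by auto
      then have "j = off i + (j - off i)" "j - off i < ns i" by auto
      with j show False by blast
    qed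
  qed simp
  then show ?thesis
    using row_sum[OF block_less[OF assms]] by (simp add: sum.reindex)
qed

lemma q_nonsingular:
  assumes "i < m"
  shows "nonsingular (ns i) (\<lambda>a b. of_bool (a = b) - q i a b + 1)"
  using assms nonneg q_row_sum irreducible block_less by (intro nonsingular_irreducible) auto

lemma t_row_sum_le: "a < nT \<Longrightarrow> (\<Sum>b<nT. t a b) \<le> 1"
proof -
  assume a: "a < nT"
  have "(\<Sum>b<nT. t a b) = (\<Sum>j\<in>(+) (off m) ` {..<nT}. p (off m + a) j)"
    by (simp add: sum.reindex)
  also have "\<dots> \<le> (\<Sum>j<n. p (off m + a) j)"
    using a by (intro sum_mono2 nonneg) (auto simp: size)
  also have "\<dots> = 1"
    using a by (intro row_sum) (simp add: size)
  finally show ?thesis .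
qed

lemma t_nonsingular: "nonsingular nT (\<lambda>a b. of_bool (a = b) - t a b)"
  using t_row_sum_le transient nonneg by (intro nonsingular_transient) (auto simp: size)

text \<open>The factor \<open>c < 1\<close> makes every row lose mass, so every nonempty set
  leaks.\<close>

lemma google_nonsingular:
  assumes "0 < c" "c < 1"
  shows "nonsingular n (\<lambda>i j. of_bool (i = j) - c * p i j)"
proof (rule nonsingular_transient)
  fix S assume S: "S \<noteq> {}" "S \<subseteq> {..<n}"
  then obtain i where i: "i \<in> S" "i < n" by blast
  have "(\<Sum>j\<in>S. c * p i j) \<le> (\<Sum>j<n. c * p i j)"
    using S i assms nonneg by (intro sum_mono2) auto
  also have "\<dots> < 1"
    using row_sum[OF i(2)] assms by (simp flip: sum_distrib_left)
  finally show "\<exists>i\<in>S. (\<Sum>j\<in>S. c * p i j) < 1" using i by blast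
qed (use assms nonneg row_sum in \<open>auto simp flip: sum_distrib_left\<close>)

lemma column_block:
  assumes "i < m" "b < ns i"
  shows "(\<Sum>l<n. x l * p l (off i + b))
    = (\<Sum>a<ns i. x (off i + a) * q i a b) + (\<Sum>a<nT. x (off m + a) * r i a b)"
proof -
  \<comment> \<open>Rows of another block \<open>k\<close> are supported in the interval of
    \<open>k\<close>, which is disjoint from that of \<open>i\<close>.\<close>
  have zero: "(\<Sum>a<ns k. x (off k + a) * p (off k + a) (off i + b)) = 0" if "k < m" "k \<noteq> i" for k
  proof (rule sum.neutral, rule ballI, rule ccontr)
    fix a assume "a \<in> {..<ns k}" "x (off k + a) * p (off k + a) (off i + b) \<noteq> 0"
    then have "off k \<le> off i + b \<and> off i + b < off k + ns k"
      using closed[of k a "off i + b"] that block_less[OF assms] by auto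
    then show False using sum_offset_disjoint[of i k b ns] that assms by auto
  qed
  have "(\<Sum>k<m. \<Sum>a<ns k. x (off k + a) * p (off k + a) (off i + b))
      = (\<Sum>k<m. if k = i then \<Sum>a<ns i. x (off i + a) * q i a b else 0)"
    using zero by (intro sum.cong) auto
  also have "\<dots> = (\<Sum>a<ns i. x (off i + a) * q i a b)"
    using assms(1) by simp
  finally show ?thesis
    unfolding size sum_split_blocks by simp
qed

text \<open>Closed blocks send nothing to the transient positions, so the transient equations form a
  system of their own.\<close>

lemma column_transient:
  assumes "b < nT"
  shows "(\<Sum>l<n. x l * p l (off m + b)) = (\<Sum>a<nT. x (off m + a) * t a b)"
proof -
  have "p (off k + a) (off m + b) = 0" if "k < m" "a < ns k" for k a
  proof (rule ccontr)
    assume "p (off k + a) (off m + b) \<noteq> 0"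
    then have "off m + b < off k + ns k"
      using closed[OF that, of "off m + b"] assms by (simp add: size)
    moreover have "off (Suc k) \<le> off m"
      using that by (intro sum_mono2) auto
    ultimately show False by simp
  qed
  then show ?thesis
    unfolding size sum_split_blocks by simp
qed

text \<open>Here \<open>v c\<close> stands for PageRank, \<open>w\<close> is the uniform row with
  entries \<open>1 / n\<close> times the inverse of I - T, and \<open>\<mu> i\<close> is the
  stationary row of block \<open>i\<close>, described by the system that contains the all-ones
  matrix.\<close>

context
  fixes v :: "real \<Rightarrow> nat \<Rightarrow> real" and w :: "nat \<Rightarrow> real" and \<mu> :: "nat \<Rightarrow> nat \<Rightarrow> real"
  assumes v: "\<And>c j. 0 < c \<Longrightarrow> c < 1 \<Longrightarrow> j < n \<Longrightarrow>
      (\<Sum>i<n. v c i * (of_bool (i = j) - c * p i j)) = (1 - c) / real n"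
    and w: "\<And>b. b < nT \<Longrightarrow> (\<Sum>a<nT. w a * (of_bool (a = b) - t a b)) = 1 / real n"
    and \<mu>: "\<And>i b. i < m \<Longrightarrow> b < ns i \<Longrightarrow>
      (\<Sum>a<ns i. \<mu> i a * (of_bool (a = b) - q i a b + 1)) = 1"
begin

section \<open>Limits on the transient part and on the closed blocks\<close>

lemma v_eq:
  assumes "0 < c" "c < 1" "j < n"
  shows "v c j = c * (\<Sum>i<n. v c i * p i j) + (1 - c) / real n"
  using v[OF assms] sum_diff_delta(2)[OF assms(3), of "v c" "\<lambda>i. c * p i j"]
  by (simp add: sum_distrib_left mult.left_commute)

text \<open>Division by \<open>1 - c\<close> makes the right side of the transient system constant,
  while its matrix tends to the nonsingular I - T.\<close>

lemma scaled_transient_limit: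
  assumes "a < nT"
  shows "((\<lambda>c. v c (off m + a) / (1 - c)) \<longlongrightarrow> w a) (at 1 within {0<..<1})"
proof (rule tendsto_row_solution[OF t_nonsingular])
  show "((\<lambda>c. of_bool (i = j) - c * t i j) \<longlongrightarrow> of_bool (i = j) - t i j) (at 1 within {0<..<1})"
    for i j by (auto intro!: tendsto_eq_intros)
  show "((\<lambda>c. 1 / real n) \<longlongrightarrow> 1 / real n) (at 1 within {0<..<1})" for j :: nat by simp
  show "\<forall>\<^sub>F c in at 1 within {0<..<1}.
      (\<Sum>i<nT. v c (off m + i) / (1 - c) * (of_bool (i = b) - c * t i b)) = 1 / real n"
    if b: "b < nT" for b
  proof (rule eventually_unit_interval)
    fix c :: real assume c: "0 < c" "c < 1"
    have "off m + b < n" using b size by simp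
    note v_eq[OF c this]
    also note column_transient[OF b, of "v c"]
    finally have eq: "v c (off m + b) - c * (\<Sum>a<nT. v c (off m + a) * t a b) = (1 - c) / real n"
      by simp
    have "(\<Sum>i<nT. v c (off m + i) / (1 - c) * (of_bool (i = b) - c * t i b))
        = (\<Sum>i<nT. v c (off m + i) * (of_bool (i = b) - c * t i b)) / (1 - c)"
      by (simp add: sum_divide_distrib)
    also have "(\<Sum>i<nT. v c (off m + i) * (of_bool (i = b) - c * t i b)) = (1 - c) / real n"
      using sum_diff_delta(2)[OF b, of "\<lambda>i. v c (off m + i)" "\<lambda>i. c * t i b"] eq
      by (simp add: sum_distrib_left mult.left_commute)
    finally show "(\<Sum>i<nT. v c (off m + i) / (1 - c) * (of_bool (i = b) - c * t i b)) = 1 / real n"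
      using c by simp
  qed
qed (use assms w in auto)

lemma transient_limit:
  assumes "a < nT"
  shows "((\<lambda>c. v c (off m + a)) \<longlongrightarrow> 0) (at 1 within {0<..<1})"
proof -
  have "((\<lambda>c. v c (off m + a) / (1 - c) * (1 - c)) \<longlongrightarrow> w a * (1 - 1)) (at 1 within {0<..<1})"
    by (intro tendsto_intros scaled_transient_limit assms)
  moreover have "\<forall>\<^sub>F c in at 1 within {0<..<1}.
      v c (off m + a) / (1 - c) * (1 - c) = v c (off m + a)"
    by (rule eventually_unit_interval) simp
  ultimately show ?thesis
    using Lim_transform_eventually by fastforce
qed

text \<open>The inflow from the transient part is \<open>1 - c\<close> times a convergent quantity,
  so the whole right side carries the factor \<open>1 - c\<close>. It vanishes in the limit, yet can
  be cancelled once the equations are summed.\<close>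

lemma block_equation:
  assumes c: "0 < c" "c < 1" and i: "i < m" "b < ns i"
  shows "v c (off i + b) - c * (\<Sum>a<ns i. v c (off i + a) * q i a b)
    = (1 - c) * (1 / real n + c * (\<Sum>a<nT. v c (off m + a) / (1 - c) * r i a b))"
    (is "?v - c * ?q = (1 - c) * (1 / real n + c * ?x)")
proof -
  have "(1 - c) * ?x = (\<Sum>a<nT. v c (off m + a) * r i a b)"
    unfolding sum_distrib_left using c by (intro sum.cong) auto
  then have "?v = c * (?q + (1 - c) * ?x) + (1 - c) / real n"
    using v_eq[OF c block_less[OF i]] column_block[OF i, of "v c"] by simp
  then show ?thesis
    by (simp only: distrib_left) (simp add: mult.left_commute)
qed

text \<open>Summed over the block, the left side becomes \<open>1 - c\<close> times the mass,
  because the rows of the block have sum 1. Cancelling \<open>1 - c\<close> determines the mass,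
  which the singular limit system v (I - Q) = 0 would leave open.\<close>

lemma block_mass:
  assumes c: "0 < c" "c < 1" and i: "i < m"
  shows "(\<Sum>a<ns i. v c (off i + a))
    = real (ns i) / real n + c * (\<Sum>a<nT. v c (off m + a) / (1 - c) * (\<Sum>b<ns i. r i a b))"
proof -
  let ?s = "\<Sum>a<ns i. v c (off i + a)"
  let ?x = "\<lambda>a. v c (off m + a) / (1 - c)"
  have "(\<Sum>b<ns i. \<Sum>a<ns i. v c (off i + a) * q i a b) = ?s * 1"
    by (rule sum_stochastic_row) (rule q_row_sum[OF i])
  then have "?s - c * ?s
      = (\<Sum>b<ns i. v c (off i + b) - c * (\<Sum>a<ns i. v c (off i + a) * q i a b))"
    by (simp add: sum_subtractf flip: sum_distrib_left)
  also have "\<dots> = (\<Sum>b<ns i. (1 - c) * (1 / real n + c * (\<Sum>a<nT. ?x a * r i a b)))"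
    by (rule sum.cong) (use block_equation[OF c i] in auto)
  also have "\<dots> = (1 - c) * (real (ns i) / real n + c * (\<Sum>b<ns i. \<Sum>a<nT. ?x a * r i a b))"
    by (simp add: sum.distrib flip: sum_distrib_left)
  also have "(\<Sum>b<ns i. \<Sum>a<nT. ?x a * r i a b) = (\<Sum>a<nT. ?x a * (\<Sum>b<ns i. r i a b))"
    by (subst sum.swap) (simp add: sum_distrib_left)
  finally have "(1 - c) * ?s
      = (1 - c) * (real (ns i) / real n + c * (\<Sum>a<nT. ?x a * (\<Sum>b<ns i. r i a b)))"
    by (simp add: left_diff_distrib)
  then show ?thesis using c by simp
qed

text \<open>Adding the mass of the block to both sides of \<open>block_equation\<close> puts the
  all-ones matrix into the system, which makes it nonsingular at \<open>c = 1\<close>. The right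
  side tends to the constant vector \<alpha>, whose solution is \<alpha> times
  \<open>\<mu> i\<close>.\<close>

lemma block_limit:
  assumes i: "i < m" and b: "b < ns i"
  defines "\<alpha> \<equiv> real (ns i) / real n + (\<Sum>a<nT. w a * (\<Sum>b<ns i. r i a b))"
  shows "((\<lambda>c. v c (off i + b)) \<longlongrightarrow> \<alpha> * \<mu> i b) (at 1 within {0<..<1})"
proof -
  let ?F = "at 1 within {0<..<1 :: real}"
  let ?x = "\<lambda>c a. v c (off m + a) / (1 - c)"
  let ?s = "\<lambda>c. real (ns i) / real n + c * (\<Sum>a<nT. ?x c a * (\<Sum>b<ns i. r i a b))"
  \<comment> \<open>The first summand is the right side of \<open>block_equation\<close> and tends
    to 0; the second is the mass of the block.\<close>
  let ?B = "\<lambda>c b. (1 - c) * (1 / real n + c * (\<Sum>a<nT. ?x c a * r i a b)) + ?s c"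
  have s: "(?s \<longlongrightarrow> real (ns i) / real n + 1 * (\<Sum>a<nT. w a * (\<Sum>b<ns i. r i a b))) ?F"
    by (intro tendsto_intros scaled_transient_limit) simp_all
  have B: "((\<lambda>c. ?B c b) \<longlongrightarrow> \<alpha>) ?F" for b
  proof -
    have "((\<lambda>c. (1 - c) * (1 / real n + c * (\<Sum>a<nT. ?x c a * r i a b)))
        \<longlongrightarrow> (1 - 1) * (1 / real n + 1 * (\<Sum>a<nT. w a * r i a b))) ?F"
      by (intro tendsto_intros scaled_transient_limit) simp_all
    from tendsto_add[OF this s] show ?thesis by (simp add: \<alpha>_def)
  qed
  show ?thesis
  proof (rule tendsto_row_solution[OF q_nonsingular[OF i] _ B _ _ b])
    show "((\<lambda>c. of_bool (a = b) - c * q i a b + 1) \<longlongrightarrow> of_bool (a = b) - q i a b + 1) ?F" for a b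
      by (auto intro!: tendsto_eq_intros)
    show "\<forall>\<^sub>F c in ?F. (\<Sum>a<ns i. v c (off i + a) * (of_bool (a = b) - c * q i a b + 1)) = ?B c b"
      if b: "b < ns i" for b
    proof (rule eventually_unit_interval)
      fix c :: real assume c: "0 < c" "c < 1"
      have "(\<Sum>a<ns i. v c (off i + a) * (of_bool (a = b) - c * q i a b + 1))
          = (\<Sum>a<ns i. v c (off i + a) * (of_bool (a = b) - c * q i a b))
            + (\<Sum>a<ns i. v c (off i + a))"
        by (simp add: distrib_left sum.distrib)
      also have "(\<Sum>a<ns i. v c (off i + a) * (of_bool (a = b) - c * q i a b))
          = v c (off i + b) - c * (\<Sum>a<ns i. v c (off i + a) * q i a b)"
        using sum_diff_delta(2)[OF b, of "\<lambda>a. v c (off i + a)" "\<lambda>a. c * q i a b"]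
        by (simp add: sum_distrib_left mult.left_commute)
      finally show "(\<Sum>a<ns i. v c (off i + a) * (of_bool (a = b) - c * q i a b + 1)) = ?B c b"
        unfolding block_equation[OF c i b] block_mass[OF c i] .
    qed
    show "(\<Sum>a<ns i. \<alpha> * \<mu> i a * (of_bool (a = b) - q i a b + 1)) = \<alpha>" if "b < ns i" for b
      using \<mu>[OF i that] by (simp add: mult.assoc flip: sum_distrib_left)
  qed
qed

end

end

text \<open>A nonzero determinant makes \<open>A\<close> a unit, which rules out \<open>None\<close>
  as the result of \<open>mat_inverse\<close>.\<close>

lemma mat_inv_nonsingular:
  assumes A: "A \<in> carrier_mat k k" and ns: "nonsingular k (\<lambda>i j. A $$ (i, j))"
  shows "invertible_mat A" "mat_inv A \<in> carrier_mat k k" "A * mat_inv A = 1\<^sub>m k"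
proof -
  have "mat k k (\<lambda>(i, j). A $$ (i, j)) = A" using A by auto
  then have "det A \<noteq> 0" using nonsingular_imp_det_nonzero[OF ns] by simp
  then have "A \<in> Units (ring_mat TYPE(real) k ())"
    by (rule det_non_zero_imp_unit[OF A])
  then obtain B where B: "mat_inverse A = Some B"
    using mat_inverse(1)[OF A, where b = "()"] by (cases "mat_inverse A") auto
  from mat_inverse(2)[OF A B] have inv: "A * B = 1\<^sub>m k" "B * A = 1\<^sub>m k" "B \<in> carrier_mat k k"
    by auto
  show "mat_inv A \<in> carrier_mat k k" "A * mat_inv A = 1\<^sub>m k"
    using inv B by (simp_all add: mat_inv_def)
  show "invertible_mat A"
    using inv A unfolding invertible_mat_def inverts_mat_def square_mat.simps by auto
qed

text \<open>With y = A^-1 z both sides equal w A y: on the left w A is the constant row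
  \<open>s\<close>, on the right A y is \<open>z\<close>.\<close>

lemma uniform_mat_inv_product:
  assumes A: "A \<in> carrier_mat k k" and ns: "nonsingular k (\<lambda>i j. A $$ (i, j))"
    and z: "z \<in> carrier_vec k"
    and w: "\<And>b. b < k \<Longrightarrow> (\<Sum>a<k. w a * A $$ (a, b)) = s"
  shows "real k * s * (uniform_vec k \<bullet> (mat_inv A *\<^sub>v z)) = (\<Sum>a<k. w a * z $ a)"
proof -
  define y where "y = mat_inv A *\<^sub>v z"
  note inv = mat_inv_nonsingular[OF A ns]
  have y: "y \<in> carrier_vec k" using inv z by (auto simp: y_def)
  have "A *\<^sub>v y = z"
    using inv z A by (simp add: y_def flip: assoc_mult_mat_vec)
  then have Ay: "(\<Sum>b<k. A $$ (a, b) * y $ b) = z $ a" if "a < k" for a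
    using that A y by (auto simp: scalar_prod_def atLeast0LessThan)
  have "real k * s * (uniform_vec k \<bullet> y) = (\<Sum>b<k. s * y $ b)"
    \<comment> \<open>The dimension cancels the weights \<open>1 / k\<close> of the uniform vector;
      for \<open>k = 0\<close> both sides are 0.\<close>
    using y by (cases "k = 0")
      (auto simp: scalar_prod_def uniform_vec_def atLeast0LessThan sum_distrib_left)
  also have "\<dots> = (\<Sum>b<k. \<Sum>a<k. w a * (A $$ (a, b) * y $ b))"
    by (rule sum.cong) (simp_all add: w[symmetric] sum_distrib_right mult.assoc)
  also have "\<dots> = (\<Sum>a<k. w a * (\<Sum>b<k. A $$ (a, b) * y $ b))"
    by (subst sum.swap) (simp add: sum_distrib_left)
  also have "\<dots> = (\<Sum>a<k. w a * z $ a)"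
    using Ay by (intro sum.cong) auto
  finally show ?thesis by (simp add: y_def)
qed

text \<open>The conjuncts before the limit ensure that the definite descriptions behind
  \<open>pagerank\<close> and \<open>stationary\<close>, and the inverse in the weights, denote what
  they should.\<close>

theorem proposition1:
  fixes W :: "nat pair_pre_digraph"
    and n m nT :: nat
    and ns :: "nat \<Rightarrow> nat"
    and P T :: "real mat"
    and Q R :: "nat \<Rightarrow> real mat"
  assumes web_graph: "pair_fin_digraph W" "pverts W = {..<n}"
    and P_def: "P = hyperlink_matrix n W"
    and dangling: "dangling_pages W \<noteq> {}"
    and pure_out: "pure_OUT n W \<noteq> {}"
    and m: "m \<ge> 1"
    and Q_dim: "\<And>i. i < m \<Longrightarrow> Q i \<in> carrier_mat (ns i) (ns i)"
    and R_dim: "\<And>i. i < m \<Longrightarrow> R i \<in> carrier_mat nT (ns i)"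
    and T_dim: "T \<in> carrier_mat nT nT"
    and block_form:
      "P = four_block_mat
             (diag_block_mat (map Q [0..<m])) (0\<^sub>m (\<Sum>i<m. ns i) nT)
             (block_row nT (map R [0..<m]))   T"
    and Q_blocks:
      "block ns ` {..<m} = {S \<in> scc_sets P. closed_set P S \<and> S \<subseteq> pure_OUT n W}"
  shows
    "(\<forall>c\<in>{0<..<1}. \<exists>!v. is_stationary (google_matrix P c) v) \<and>
     (\<forall>i<m. \<exists>!v. is_stationary (Q i) v) \<and>
     invertible_mat (1\<^sub>m nT - T) \<and>
     vec_tendsto (pagerank P)
       (foldr (@\<^sub>v)
          (map (\<lambda>i. (real (ns i) / real n
                     + real nT / real n
                       * (uniform_vec nT \<bullet> (mat_inv (1\<^sub>m nT - T) *\<^sub>v (R i *\<^sub>v ones_vec (ns i)))))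
                    \<cdot>\<^sub>v stationary (Q i)) [0..<m])
          (0\<^sub>v nT))
       (at 1 within {0<..<1})"
proof -
  let ?off = "\<lambda>i. \<Sum>k<i. ns k"
  let ?p = "\<lambda>i j. P $$ (i, j)"
  note V = web_graph(2)

  \<comment> \<open>Sizes and entries of the blocks\<close>
  have P: "P \<in> carrier_mat n n"
    unfolding P_def by (rule hyperlink_matrix_carrier)
  have diag: "dim_row (diag_block_mat (map Q [0..<m])) = ?off m"
    "dim_col (diag_block_mat (map Q [0..<m])) = ?off m"
    using dim_diag_block_mat_upt[of m Q ns] Q_dim by auto
  have size: "n = ?off m + nT"
    using P T_dim diag unfolding block_form by auto
  have P_Q: "?p (?off i + a) (?off i + b) = Q i $$ (a, b)" if "i < m" "a < ns i" "b < ns i" for i a b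
    using diag_block_mat_index[of m Q ns i a b] Q_dim that sum_offset_bound[of i m a ns]
      sum_offset_bound[of i m b ns] diag T_dim
    unfolding block_form by auto
  have P_R: "?p (?off m + a) (?off i + b) = R i $$ (a, b)" if "i < m" "a < nT" "b < ns i" for i a b
    using block_row_index[of m R nT ns i a b] R_dim sum_offset_bound[of i m b ns] that diag T_dim
    unfolding block_form by auto
  have P_T: "?p (?off m + a) (?off m + b) = T $$ (a, b)" if "a < nT" "b < nT" for a b
    using that diag T_dim unfolding block_form by auto
  have block: "block ns i = {?off i..<?off i + ns i}" for i
    by (simp add: block_def lessThan_Suc_atMost[symmetric])
  have scc: "block ns i \<in> scc_sets P" and closed: "closed_set P (block ns i)" if "i < m" for i
    using that Q_blocks by blast+
  have block_sub: "block ns i \<subseteq> {..<n}" if "i < m" for i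
    by (rule scc_sets_subset[OF P scc[OF that]])
  have row_sum: "(\<Sum>j<n. ?p i j) = 1" if "i < n" for i
    unfolding P_def by (rule hyperlink_matrix_row_sum[OF web_graph that])
  have nonneg: "0 \<le> ?p i j" if "i < n" "j < n" for i j
    unfolding P_def using that by (rule hyperlink_matrix_nonneg)

  \<comment> \<open>The hyperlink matrix as an absorbing chain\<close>
  interpret absorbing_chain n m nT ns ?p
  proof
    fix i a j
    assume i: "i < m" "a < ns i" and j: "j < n" "?p (?off i + a) j \<noteq> 0"
    have "?off i + a \<in> block ns i" using i by (simp add: block)
    moreover from this have "0 < ?p (?off i + a) j"
      using nonneg[of "?off i + a" j] block_sub[OF i(1)] j by force
    ultimately have "j \<in> block ns i"
      using closed[OF i(1)] closed_set_iff[OF P block_sub[OF i(1)]] j by blast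
    then show "?off i \<le> j \<and> j < ?off i + ns i" by (simp add: block)
  next
    fix i S
    assume i: "i < m" and S: "S \<noteq> {}" "S \<subseteq> {..<ns i}"
      and step: "\<forall>a\<in>S. \<forall>b<ns i. 0 < ?p (?off i + a) (?off i + b) \<longrightarrow> b \<in> S"
    \<comment> \<open>Shifted to page numbers, \<open>S\<close> becomes a nonempty closed subset of
      a strongly connected component, hence all of it.\<close>
    let ?C = "(+) (?off i) ` S"
    have sub: "?C \<subseteq> block ns i" using S(2) by (auto simp: block)
    have "closed_set P ?C"
      unfolding closed_set_iff[OF P order_trans[OF sub block_sub[OF i]]]
    proof (intro ballI allI impI)
      fix x j assume x: "x \<in> ?C" and j: "j < n" "0 < ?p x j"
      then obtain a where a: "a \<in> S" "x = ?off i + a" by blast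
      have "j \<in> block ns i"
        using closed[OF i] closed_set_iff[OF P block_sub[OF i]] sub x j by blast
      then obtain b where b: "b < ns i" "j = ?off i + b"
        unfolding block by (metis add_diff_inverse_nat atLeastLessThan_iff nat_add_left_cancel_less not_less)
      then show "j \<in> ?C" using step a j by blast
    qed
    then have "?C = block ns i"
      using closed_subset_scc_eq[OF scc[OF i] _ sub] S(1) by blast
    moreover have "block ns i = (+) (?off i) ` {..<ns i}"
      by (simp add: block lessThan_atLeast0 add.commute)
    ultimately show "S = {..<ns i}"
      by (simp add: inj_image_eq_iff)
  next
    fix S assume S: "S \<noteq> {}" "S \<subseteq> {..<nT}"
    show "\<exists>a\<in>S. (\<Sum>b\<in>S. ?p (?off m + a) (?off m + b)) < 1"
    \<comment> \<open>If no position of \<open>S\<close> lost mass, the pages of \<open>S\<close>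
      would form a closed set. But they reach an absorbing component in Pure OUT, and by
      \<open>Q_blocks\<close> it lies among the blocks before the transient positions.\<close>
    proof (rule ccontr)
      assume "\<not> ?thesis"
      then have ge1: "1 \<le> (\<Sum>b\<in>S. ?p (?off m + a) (?off m + b))" if "a \<in> S" for a
        using that by force
      let ?C = "(+) (?off m) ` S"
      have sub: "?C \<subseteq> {..<n}" using S(2) size by auto
      have "closed_set P ?C"
        unfolding closed_set_iff[OF P sub]
      proof (intro ballI allI impI, rule ccontr)
        fix x j assume x: "x \<in> ?C" and j: "j < n" "0 < ?p x j" "j \<notin> ?C"
        then obtain a where a: "a \<in> S" "x = ?off m + a" by blast
        have xn: "x < n" using sub x by blast
        \<comment> \<open>Positive weight on a page outside would push the row sum above 1.\<close>
        have "1 \<le> (\<Sum>l\<in>?C. ?p x l)"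
          using ge1[OF a(1)] by (simp add: sum.reindex a(2))
        also have "\<dots> < (\<Sum>l\<in>insert j ?C. ?p x l)"
          using j finite_subset[OF sub] by simp
        also have "\<dots> \<le> (\<Sum>l<n. ?p x l)"
          using sub j xn nonneg by (intro sum_mono2) auto
        finally show False using row_sum[OF xn] by simp
      qed
      obtain u where u: "u \<in> ?C" "u < n" using S(1) sub by blast
      obtain B where B: "B \<in> scc_sets P" "closed_set P B" "B \<subseteq> pure_OUT n W"
        "\<And>v. v \<in> B \<Longrightarrow> u \<rightarrow>\<^sup>*\<^bsub>with_proj (matrix_graph P)\<^esub> v"
        using absorbing_component_reachable[OF V dangling pure_out u(2)] unfolding P_def by blast
      then have "B \<in> block ns ` {..<m}" unfolding Q_blocks by blast
      then obtain i where i: "i < m" "B = block ns i" by blast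
      have "B \<noteq> {}"
        using B(1) by (simp add: scc_sets_def pre_digraph.sccs_verts_def)
      then obtain v where v: "v \<in> B" by blast
      have "v \<in> ?C"
        by (rule closed_set_reachable[OF \<open>closed_set P ?C\<close> u(1) B(4)[OF v]])
      then have "?off m \<le> v" by auto
      moreover have "v < ?off (Suc i)" using v i by (simp add: block)
      moreover have "?off (Suc i) \<le> ?off m" using i(1) by (intro sum_mono2) auto
      ultimately show False by linarith
    qed
  qed (use size nonneg row_sum in auto)

  \<comment> \<open>Existence and uniqueness of the stationary vectors\<close>
  have "dangling_pages W \<subseteq> {..<n}"
    unfolding dangling_pages_def V by blast
  with dangling have n: "0 < n" by auto
  have google: "is_stationary (google_matrix P c) v \<longleftrightarrow> v \<in> carrier_vec n \<and>
      (\<forall>j<n. (\<Sum>i<n. v $ i * (of_bool (i = j) - c * ?p i j)) = (1 - c) / real n)"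
    if "0 < c" "c < 1" for c v
    using is_stationary_google_iff[OF P n _ row_sum] that by simp
  have google_ex1: "\<exists>!v. is_stationary (google_matrix P c) v" if "0 < c" "c < 1" for c
    unfolding google[OF that] by (rule nonsingular_ex1_vec[OF google_nonsingular[OF that]])
  have pagerank: "is_stationary (google_matrix P c) (pagerank P c)" if "0 < c" "c < 1" for c
    unfolding pagerank_def stationary_def by (rule theI'[OF google_ex1[OF that]])
  have Q_stat: "is_stationary (Q i) v \<longleftrightarrow> v \<in> carrier_vec (ns i) \<and>
      (\<forall>b<ns i. (\<Sum>a<ns i. v $ a * (of_bool (a = b) - q i a b + 1)) = 1)" if i: "i < m" for i v
  proof -
    \<comment> \<open>Components are nonempty; the positive size is needed to recover mass 1 from
      \<open>k\<close> times the mass.\<close>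
    have "block ns i \<noteq> {}"
      using scc[OF i] by (simp add: scc_sets_def pre_digraph.sccs_verts_def)
    then have "0 < ns i" by (simp add: block)
    moreover have "(\<Sum>b<ns i. Q i $$ (a, b)) = 1" if "a < ns i" for a
      using q_row_sum[OF i that] P_Q[OF i that] by simp
    ultimately show ?thesis
      using is_stationary_irreducible_iff[OF Q_dim[OF i]] P_Q[OF i] by simp
  qed
  have Q_ex1: "\<exists>!v. is_stationary (Q i) v" if "i < m" for i
    unfolding Q_stat[OF that] by (rule nonsingular_ex1_vec[OF q_nonsingular[OF that]])
  have Q_stationary: "is_stationary (Q i) (stationary (Q i))" if "i < m" for i
    unfolding stationary_def by (rule theI'[OF Q_ex1[OF that]])

  \<comment> \<open>The inverse of I - T and the limiting masses\<close>
  have IT: "1\<^sub>m nT - T \<in> carrier_mat nT nT" using T_dim by auto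
  have IT_index: "(1\<^sub>m nT - T) $$ (a, b) = of_bool (a = b) - t a b" if "a < nT" "b < nT" for a b
    using that T_dim by (simp add: P_T)
  have IT_nonsingular: "nonsingular nT (\<lambda>a b. (1\<^sub>m nT - T) $$ (a, b))"
    using t_nonsingular by (simp add: IT_index cong: nonsingular_cong)
  \<comment> \<open>This solution links the two forms of the weights: it is the limit of the scaled
    transient part, and pairing it with the row sums of \<open>R i\<close> gives the expression with
    \<open>mat_inv\<close>.\<close>
  obtain w where w: "\<And>b. b < nT \<Longrightarrow> (\<Sum>a<nT. w a * (of_bool (a = b) - t a b)) = 1 / real n"
    using nonsingular_row_solution[OF t_nonsingular, of "\<lambda>_. 1 / real n"] by blast
  define \<alpha> where "\<alpha> i = real (ns i) / real n + real nT / real n *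
      (uniform_vec nT \<bullet> (mat_inv (1\<^sub>m nT - T) *\<^sub>v (R i *\<^sub>v ones_vec (ns i))))" for i
  have \<alpha>: "\<alpha> i = real (ns i) / real n + (\<Sum>a<nT. w a * (\<Sum>b<ns i. r i a b))" if i: "i < m" for i
  proof -
    let ?z = "R i *\<^sub>v ones_vec (ns i)"
    have "?z \<in> carrier_vec nT" using R_dim[OF i] by (auto simp: ones_vec_def)
    moreover have "(\<Sum>a<nT. w a * (1\<^sub>m nT - T) $$ (a, b)) = 1 / real n" if "b < nT" for b
      using w[OF that] IT_index[OF _ that] by simp
    ultimately have "real nT * (1 / real n) * (uniform_vec nT \<bullet> (mat_inv (1\<^sub>m nT - T) *\<^sub>v ?z))
        = (\<Sum>a<nT. w a * ?z $ a)"
      by (rule uniform_mat_inv_product[OF IT IT_nonsingular])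
    moreover have "?z $ a = (\<Sum>b<ns i. r i a b)" if "a < nT" for a
      using R_dim[OF i] that P_R[OF i that]
      by (simp add: scalar_prod_def ones_vec_def atLeast0LessThan)
    ultimately show ?thesis by (simp add: \<alpha>_def)
  qed
  let ?f = "\<lambda>i. \<alpha> i \<cdot>\<^sub>v stationary (Q i)"
  let ?l = "foldr (@\<^sub>v) (map ?f [0..<m]) (0\<^sub>v nT)"
  have dim_f: "dim_vec (?f i) = ns i" if "i < m" for i
    using Q_stationary[OF that] Q_stat[OF that] by auto
  have dim_l: "dim_vec ?l = n"
    using dim_foldr_append_vec[of m ?f ns "0\<^sub>v nT"] dim_f size by simp
  have v: "(\<Sum>i<n. pagerank P c $ i * (of_bool (i = j) - c * ?p i j)) = (1 - c) / real n"
    if "0 < c" "c < 1" "j < n" for c j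
    using pagerank[OF that(1,2)] google[OF that(1,2)] that(3) by blast
  have \<mu>: "(\<Sum>a<ns i. stationary (Q i) $ a * (of_bool (a = b) - q i a b + 1)) = 1"
    if "i < m" "b < ns i" for i b
    using Q_stationary[OF that(1)] Q_stat[OF that(1)] that(2) by blast

  \<comment> \<open>Componentwise convergence\<close>
  have "vec_tendsto (pagerank P) ?l (at 1 within {0<..<1})"
    unfolding vec_tendsto_def dim_l
  proof (intro conjI allI impI)
    show "\<forall>\<^sub>F c in at 1 within {0<..<1}. dim_vec (pagerank P c) = n"
      by (intro eventually_unit_interval carrier_vecD) (use pagerank google in blast)
    fix j assume j: "j < n"
    show "((\<lambda>c. pagerank P c $ j) \<longlongrightarrow> ?l $ j) (at 1 within {0<..<1})"
    proof (cases "j < ?off m")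
      case True
      then obtain i b where i: "i < m" "b < ns i" and [simp]: "j = ?off i + b"
        by (rule sum_offset_cover)
      have "?l $ j = \<alpha> i * stationary (Q i) $ b"
        using foldr_append_vec_index[of m ?f ns i b "0\<^sub>v nT"] dim_f i by simp
      moreover have "((\<lambda>c. pagerank P c $ (?off i + b)) \<longlongrightarrow>
          \<alpha> i * stationary (Q i) $ b) (at 1 within {0<..<1})"
        unfolding \<alpha>[OF i(1)] by (rule block_limit[OF v w \<mu> i])
      ultimately show ?thesis by simp
    next
      case False
      then obtain a where a: "j = ?off m + a" "a < nT"
        using j size by (metis add_diff_inverse_nat nat_add_left_cancel_less)
      have "?l $ j = 0"
        using foldr_append_vec_index_last[of m ?f ns a "0\<^sub>v nT"] dim_f a by simp
      then show ?thesis
        using transient_limit[OF v w \<mu> a(2)] a(1) by simp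
    qed
  qed
  then show ?thesis
    using google_ex1 Q_ex1 mat_inv_nonsingular(1)[OF IT IT_nonsingular]
    by (auto simp: \<alpha>_def)
qed

end
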